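(* Let $0<\lambda\le1$, $\varphi\in\mathcal{K}$ and $f\in\mathcal{F}_H^0(\lambda)$. Then $(\alpha\overline{\varphi}+\varphi)*f\in\mathcal{F}_H^0(\lambda)$ for every $\alpha\in\mathbb{C}$ with $|\alpha|\le1$.
   Context: $\mathbb{D}=\{z\in\mathbb{C}:|z|<1\}$. $\mathcal{K}$ is the class of analytic univalent functions $\varphi$ in $\mathbb{D}$ with $\varphi(0)=0$, $\varphi'(0)=1$ and $\varphi(\mathbb{D})$ convex. For $0<\lambda\le1$, $\mathcal{F}_H^0(\lambda)$ is the class of all complex-valued harmonic functions $f$ in $\mathbb{D}$ with $f(0)=0$, $f_z(0)=1$, $f_{\bar z}(0)=0$ and $|f_z(z)-1|<\lambda-|f_{\bar z}(z)|$ for all $z\in\mathbb{D}$. For analytic functions $p(z)=\sum_{n\ge1} p_nz^n$ and $q(z)=\sum_{n\ge1} q_nz^n$ in $\mathbb{D}$, $p*q$ denotes the Hadamard product $\sum_{n\ge1} p_nq_nz^n$. For harmonic functions $f=h+\overline{g}$ and $F=H+\overline{G}$, with $h,g,H,G$ analytic in $\mathbb{D}$ and vanishing at $0$, the harmonic convolution is $f*F=h*H+\overline{g*G}$. Thus for $f=h+\overline g$ one has $(\alpha\overline\varphi+\varphi)*f=\varphi*h+\overline{\overline{\alpha}\,(\varphi*g)}$. *)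

theory Defs
  imports "HOL-Complex_Analysis.Complex_Analysis"
begin

abbreviation unit_disc :: "complex set" where
  "unit_disc \<equiv> ball 0 1"

text \<open>
  Real partial derivatives with respect to \<open>x\<close> and \<open>y\<close> (\<open>z = x + \<i>y\<close>) and the derivatives
  \<open>f\<^sub>z\<close> and \<open>f\<close>-\<open>z\<close>-bar built from them. They are meaningful only where \<open>f\<close> is real differentiable.
\<close>

definition partial_x :: "(complex \<Rightarrow> complex) \<Rightarrow> complex \<Rightarrow> complex" where
  "partial_x f z = frechet_derivative f (at z) 1"

definition partial_y :: "(complex \<Rightarrow> complex) \<Rightarrow> complex \<Rightarrow> complex" where
  "partial_y f z = frechet_derivative f (at z) \<i>"

definition deriv_z :: "(complex \<Rightarrow> complex) \<Rightarrow> complex \<Rightarrow> complex" where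
  "deriv_z f z = (partial_x f z - \<i> * partial_y f z) / 2"

definition deriv_zbar :: "(complex \<Rightarrow> complex) \<Rightarrow> complex \<Rightarrow> complex" where
  "deriv_zbar f z = (partial_x f z + \<i> * partial_y f z) / 2"

text \<open>Used for open \<open>S\<close> only: \<open>f\<close> is twice continuously differentiable and satisfies the Laplace equation.\<close>

definition harmonic_on :: "(complex \<Rightarrow> complex) \<Rightarrow> complex set \<Rightarrow> bool" where
  "harmonic_on f S \<longleftrightarrow>
     f differentiable_on S \<and>
     partial_x f differentiable_on S \<and> partial_y f differentiable_on S \<and>
     continuous_on S (partial_x (partial_x f)) \<and> continuous_on S (partial_x (partial_y f)) \<and>
     continuous_on S (partial_y (partial_x f)) \<and> continuous_on S (partial_y (partial_y f)) \<and>
     (\<forall>z\<in>S. partial_x (partial_x f) z + partial_y (partial_y f) z = 0)"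

definition convex_univalent :: "(complex \<Rightarrow> complex) set" where
  "convex_univalent = {\<phi>. \<phi> holomorphic_on unit_disc \<and> inj_on \<phi> unit_disc \<and>
     \<phi> 0 = 0 \<and> deriv \<phi> 0 = 1 \<and> convex (\<phi> ` unit_disc)}"

definition FH0 :: "real \<Rightarrow> (complex \<Rightarrow> complex) set" where
  "FH0 r = {f. harmonic_on f unit_disc \<and> f 0 = 0 \<and> deriv_z f 0 = 1 \<and> deriv_zbar f 0 = 0 \<and>
     (\<forall>z\<in>unit_disc. cmod (deriv_z f z - 1) < r - cmod (deriv_zbar f z))}"

definition taylor_coeff :: "(complex \<Rightarrow> complex) \<Rightarrow> nat \<Rightarrow> complex" where
  "taylor_coeff p n = (deriv ^^ n) p 0 / fact n"

text \<open>The sum starts at the linear term: the factors are meant to vanish at \<open>0\<close>.\<close>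

definition hadamard :: "(complex \<Rightarrow> complex) \<Rightarrow> (complex \<Rightarrow> complex) \<Rightarrow> complex \<Rightarrow> complex" where
  "hadamard p q z = (\<Sum>n. taylor_coeff p (Suc n) * taylor_coeff q (Suc n) * z ^ Suc n)"

definition canonical_decomp ::
    "(complex \<Rightarrow> complex) \<Rightarrow> (complex \<Rightarrow> complex) \<Rightarrow> (complex \<Rightarrow> complex) \<Rightarrow> bool" where
  "canonical_decomp f h g \<longleftrightarrow> h holomorphic_on unit_disc \<and> g holomorphic_on unit_disc \<and>
     h 0 = 0 \<and> g 0 = 0 \<and> (\<forall>z\<in>unit_disc. f z = h z + cnj (g z))"

text \<open>
  On the disc the decompositions exist for harmonic functions vanishing at \<open>0\<close>, and they are
  unique there. Only Taylor coefficients at \<open>0\<close> enter the value, so it is uniquely determined.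
\<close>

definition harmonic_conv ::
    "(complex \<Rightarrow> complex) \<Rightarrow> (complex \<Rightarrow> complex) \<Rightarrow> complex \<Rightarrow> complex" where
  "harmonic_conv f F z = (THE w. \<exists>h g H G. canonical_decomp f h g \<and> canonical_decomp F H G \<and>
     w = hadamard h H z + cnj (hadamard g G z))"

end

theory Submission
  imports Defs
begin

text \<open>
  Write \<open>f = h + cnj g\<close> with \<open>h\<close>, \<open>g\<close> holomorphic in the disc. Then \<open>deriv_z f = h'\<close> and
  \<open>deriv_zbar f = cnj g'\<close>, and the hypothesis on \<open>f\<close> says that every combination
  \<open>F = h + u g\<close> with \<open>|u| = 1\<close> satisfies \<open>|F' - 1| < r\<close>. Conversely, choosing \<open>u\<close> so that
  \<open>|p + u q| = |p| + |q|\<close> recovers the harmonic condition from the holomorphic ones. Since convolution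
  with \<open>\<phi>\<close> is linear, it suffices to show for a single holomorphic \<open>F\<close> that \<open>|F' - 1| < r\<close>
  passes to \<open>\<phi> * F\<close> (\<open>hadamard_deriv_bound\<close>). The factor \<open>\<alpha>\<close> only shrinks the antiholomorphic
  part.

  For that step, \<open>(\<phi> * F)'\<close> is the coefficientwise product of \<open>\<phi>(z)/z\<close> and \<open>F'\<close>. The theorem of Marx
  and Strohhaecker (\<open>marx_strohhaecker\<close>) says that \<open>Re (\<phi>(z)/z) \<ge> 1/2\<close> for convex \<open>\<phi>\<close>, so
  \<open>2 Re (\<phi>(z)/z) - 1\<close> is a nonnegative kernel with mean value \<open>1\<close>. Convolving with \<open>\<phi>(z)/z\<close> averages
  \<open>F' - 1\<close> against this kernel over a circle, and averaging does not increase a supremum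
  (\<open>hadamard_sum_bound\<close>); by the Schwarz lemma the supremum over a circle inside the disc is
  strictly below \<open>r\<close>.

  The Marx--Strohhaecker theorem is obtained in two uses of one boundary principle
  (\<open>log_derivative_at_disc_maximum\<close>): where the modulus of \<open>\<psi>\<close> on a disc is maximal,
  \<open>z \<psi>'(z)/\<psi>(z)\<close> is real and nonnegative. Pulling the segments between \<open>\<phi>(z)\<close> and \<open>\<phi>(xz)\<close> back to the
  disc gives \<open>Re ((\<phi>(z) - \<phi>(xz))/(z \<phi>'(z))) \<ge> 0\<close> for \<open>|x| \<le> 1\<close>; this function of \<open>x\<close> vanishes at
  \<open>x = 1\<close>, and the principle at that boundary point gives \<open>Re (z \<phi>'(z)/\<phi>(z)) \<ge> 1/2\<close>. The principle
  applied to \<open>1 - z/\<phi>(z)\<close>, divided by \<open>z\<close>, then turns this into \<open>|1 - z/\<phi>(z)| \<le> 1\<close>, which is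
  \<open>Re (\<phi>(z)/z) \<ge> 1/2\<close>.
\<close>

section \<open>Convex univalent functions and the Marx--Strohhaecker theorem\<close>

lemma convex_univalentD:
  assumes "\<phi> \<in> convex_univalent"
  shows "\<phi> holomorphic_on unit_disc" "inj_on \<phi> unit_disc" "\<phi> 0 = 0" "deriv \<phi> 0 = 1"
    "convex (\<phi> ` unit_disc)"
  using assms by (auto simp: convex_univalent_def)

lemma convex_univalent_deriv_nonzero:
  assumes "\<phi> \<in> convex_univalent" "z \<in> unit_disc"
  shows "deriv \<phi> z \<noteq> 0"
proof -
  note c = convex_univalentD[OF assms(1)]
  obtain g where "\<And>z. z \<in> unit_disc \<Longrightarrow> deriv \<phi> z * deriv g (\<phi> z) = 1"
    using holomorphic_has_inverse[OF c(1) open_ball c(2)] by metis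
  from this[OF assms(2)] show ?thesis by auto
qed

lemma convex_univalent_nonzero:
  assumes "\<phi> \<in> convex_univalent" "z \<in> unit_disc" "z \<noteq> 0"
  shows "\<phi> z \<noteq> 0"
  using convex_univalentD(2,3)[OF assms(1)] assms(2,3) unfolding inj_on_def
  by (metis centre_in_ball zero_less_one)

text \<open>
  A point that starts on a circle about \<open>0\<close> and does not leave the closed disc moves in a direction
  that makes at least a right angle with the outward radius.
\<close>

lemma curve_leaving_max_modulus:
  fixes c :: "real \<Rightarrow> complex"
  assumes der: "(c has_vector_derivative d) (at 0)"
    and le: "eventually (\<lambda>s. cmod (c s) \<le> cmod (c 0)) (at_right 0)"
  shows "Re (cnj (c 0) * d) \<le> 0"
proof (rule ccontr)
  define u where "u s = Re (cnj (c 0) * c s)" for s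
  assume "\<not> ?thesis"
  moreover have "(u has_real_derivative Re (cnj (c 0) * d)) (at 0)"
  proof -
    have "((\<lambda>s. cnj (c 0) * c s) has_vector_derivative cnj (c 0) * d) (at 0)"
      by (rule bounded_linear.has_vector_derivative[OF bounded_linear_mult_right der])
    thus ?thesis
      unfolding u_def has_real_derivative_iff_has_vector_derivative
      by (rule bounded_linear.has_vector_derivative[OF bounded_linear_Re])
  qed
  ultimately obtain e where e: "e > 0" "\<And>h. 0 < h \<Longrightarrow> h < e \<Longrightarrow> u 0 < u h"
    using DERIV_pos_inc_right[of u "Re (cnj (c 0) * d)" 0] by auto
  obtain b where b: "b > 0" "\<And>h. 0 < h \<Longrightarrow> h < b \<Longrightarrow> cmod (c h) \<le> cmod (c 0)"
    using le unfolding eventually_at_right_field by auto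
  define h where "h = min e b / 2"
  have h: "0 < h" "h < e" "h < b" using e(1) b(1) by (auto simp: h_def min_def)
  have "u h \<le> cmod (cnj (c 0) * c h)"
    unfolding u_def by (rule complex_Re_le_cmod)
  also have "\<dots> \<le> cmod (c 0) * cmod (c 0)"
    using b(2)[OF h(1,3)] by (simp add: norm_mult mult_left_mono)
  also have "\<dots> = u 0"
    by (simp add: u_def cmod_power2 flip: power2_eq_square)
  finally show False using e(2)[OF h(1,2)] by simp
qed

text \<open>
  Let \<open>L = z0 D/\<psi>(z0)\<close>. Moving from \<open>z0\<close> in a direction \<open>z0 v\<close> with \<open>Re v < 0\<close> enters the disc, where
  \<open>|\<psi>|\<close> is not larger, so \<open>Re (L v) \<le> 0\<close>. Multiplication by \<open>L\<close> thus keeps the left half-plane in its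
  closure, so \<open>L\<close> is real and nonnegative. For \<open>\<psi>(z) = \<omega>(z)/z\<close> this is Jack's
  lemma about \<open>\<omega>\<close>.
\<close>

lemma log_derivative_at_disc_maximum:
  assumes der: "(\<psi> has_field_derivative D) (at z0)"
    and nz: "z0 \<noteq> 0" "\<psi> z0 \<noteq> 0"
    and max: "\<And>z. cmod z < cmod z0 \<Longrightarrow> cmod (\<psi> z) \<le> cmod (\<psi> z0)"
  shows "Im (z0 * D / \<psi> z0) = 0" and "Re (z0 * D / \<psi> z0) \<ge> 0"
proof -
  define L where "L = z0 * D / \<psi> z0"
  have half_plane: "Re (L * v) \<le> 0" if v: "Re v < 0" for v
  proof -
    define c where "c s = \<psi> (z0 + of_real s * (z0 * v))" for s :: real
    have 1: "((\<lambda>s. z0 + of_real s * (z0 * v)) has_vector_derivative z0 * v) (at 0)"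
      by (auto intro!: derivative_eq_intros simp: has_vector_derivative_def scaleR_conv_of_real)
    have der_c: "(c has_vector_derivative (z0 * v) * D) (at 0)"
      unfolding c_def
      using field_vector_diff_chain_at[OF 1, of \<psi> D] der by (simp add: o_def)
    have "v \<noteq> 0" using v by auto
    \<comment> \<open>\<open>|1 + s v| < 1\<close> holds exactly for \<open>0 < s < b\<close>\<close>
    define b where "b = - 2 * Re v / (cmod v)\<^sup>2"
    have "b > 0" using v \<open>v \<noteq> 0\<close> by (simp add: b_def divide_neg_pos)
    have "cmod (c s) \<le> cmod (c 0)" if s: "0 < s" "s < b" for s
    proof -
      have "s * (cmod v)\<^sup>2 < - 2 * Re v"
        using s(2) \<open>v \<noteq> 0\<close> pos_less_divide_eq[of "(cmod v)\<^sup>2" s "- 2 * Re v"] by (simp add: b_def)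
      hence "s * (s * (cmod v)\<^sup>2) < s * (- 2 * Re v)" using s(1) by (rule mult_strict_left_mono)
      hence "(cmod (1 + of_real s * v))\<^sup>2 < 1"
        unfolding cmod_power2 by (simp add: power2_eq_square algebra_simps)
      hence "cmod (1 + of_real s * v) < 1" by (simp add: power_less_one_iff)
      hence "cmod z0 * cmod (1 + of_real s * v) < cmod z0" using nz(1) by simp
      hence "cmod (z0 + of_real s * (z0 * v)) < cmod z0"
        by (metis (no_types, opaque_lifting) distrib_left mult.left_commute mult.right_neutral norm_mult)
      thus ?thesis using max by (simp add: c_def)
    qed
    hence "eventually (\<lambda>s. cmod (c s) \<le> cmod (c 0)) (at_right 0)"
      unfolding eventually_at_right_field using \<open>b > 0\<close> by blast
    from curve_leaving_max_modulus[OF der_c this]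
    have "Re (cnj (\<psi> z0) * (z0 * v * D)) \<le> 0" by (simp add: c_def)
    moreover have "L * v = (cnj (\<psi> z0) * (z0 * v * D)) / of_real ((cmod (\<psi> z0))\<^sup>2)"
      using nz(2) unfolding complex_norm_square L_def by (simp add: divide_simps)
    ultimately show ?thesis by (simp only: Re_divide_of_real) (simp add: divide_nonpos_nonneg)
  qed
  \<comment> \<open>the directions \<open>-1 + ik\<close>, with \<open>k\<close> large of either sign, force \<open>Im L = 0\<close>\<close>
  have *: "- Re L - k * Im L \<le> 0" for k
    using half_plane[of "Complex (-1) k"] by (simp add: mult.commute)
  have "Im L = 0"
  proof (rule ccontr)
    assume "Im L \<noteq> 0"
    thus False using *[of "- (Re L + 1) / Im L"] by simp
  qed
  thus "Im (z0 * D / \<psi> z0) = 0" "Re (z0 * D / \<psi> z0) \<ge> 0"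
    using *[of 0] by (auto simp: L_def)
qed

text \<open>
  Here the convexity of the image enters. For \<open>t \<in> [0,1]\<close> the function \<open>(1 - t) \<phi>(\<zeta>) + t \<phi>(x\<zeta>)\<close> takes values in
  the image of \<open>\<phi>\<close>, so composing it with the inverse of \<open>\<phi>\<close> gives a self-map of the disc that fixes
  \<open>0\<close>. By the Schwarz lemma the point \<open>z\<close> does not move outward as \<open>t\<close> leaves \<open>0\<close>, and its initial
  velocity is \<open>(\<phi>(xz) - \<phi>(z))/\<phi>'(z)\<close>.
\<close>

lemma convex_univalent_chord:
  assumes \<phi>: "\<phi> \<in> convex_univalent" and z: "z \<in> unit_disc" "z \<noteq> 0" and x: "cmod x \<le> 1"
  shows "Re ((\<phi> z - \<phi> (x * z)) / (z * deriv \<phi> z)) \<ge> 0"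
proof -
  note c = convex_univalentD[OF \<phi>]
  obtain g where g: "g holomorphic_on \<phi> ` unit_disc"
      "\<And>z. z \<in> unit_disc \<Longrightarrow> deriv \<phi> z * deriv g (\<phi> z) = 1"
      "\<And>z. z \<in> unit_disc \<Longrightarrow> g (\<phi> z) = z"
    using holomorphic_has_inverse[OF c(1) open_ball c(2)] by metis
  have op: "open (\<phi> ` unit_disc)" by (rule open_mapping_thm3[OF c(1) open_ball c(2)])
  have scaled: "x * w \<in> unit_disc" if "w \<in> unit_disc" for w
    using mult_mono[of "cmod x" 1 "cmod w" "cmod w"] x that by (simp add: norm_mult)
  define W where "W t w = of_real (1 - t) * \<phi> w + of_real t * \<phi> (x * w)" for t :: real and w
  have W_mem: "W t w \<in> \<phi> ` unit_disc" if "t \<in> {0..1}" "w \<in> unit_disc" for t w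
    using convexD[OF c(5), of "\<phi> w" "\<phi> (x * w)" "1 - t" t] that scaled[of w]
    by (auto simp: W_def scaleR_conv_of_real)
  have hol_W: "W t holomorphic_on unit_disc" for t
  proof -
    have "(\<lambda>w. \<phi> (x * w)) holomorphic_on unit_disc"
      using holomorphic_on_compose_gen[of "\<lambda>w. x * w" unit_disc \<phi> unit_disc] c(1) scaled
      by (simp add: o_def image_subset_iff holomorphic_intros)
    thus ?thesis unfolding W_def by (intro holomorphic_intros c(1))
  qed
  have schwarz: "cmod (g (W t z)) \<le> cmod z" if t: "t \<in> {0..1}" for t
  proof (rule Schwarz_Lemma(1))
    show "(\<lambda>w. g (W t w)) holomorphic_on ball 0 1"
      using holomorphic_on_compose_gen[OF hol_W g(1), of t] W_mem[OF t]
      by (simp add: o_def image_subset_iff)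
    show "g (W t 0) = 0" using g(3)[of 0] c(3) by (simp add: W_def)
    show "cmod (g (W t w)) < 1" if "cmod w < 1" for w
      using W_mem[OF t, of w] that g(3) by fastforce
    show "cmod z < 1" using z by simp
  qed
  define \<gamma> where "\<gamma> t = g (W t z)" for t
  have \<gamma>0: "\<gamma> 0 = z" using g(3)[OF z(1)] by (simp add: \<gamma>_def W_def)
  have 1: "((\<lambda>t. W t z) has_vector_derivative (\<phi> (x * z) - \<phi> z)) (at 0)"
    unfolding W_def
    by (auto intro!: derivative_eq_intros simp: has_vector_derivative_def scaleR_conv_of_real algebra_simps)
  have "g field_differentiable at (\<phi> z)"
    using g(1) op z(1) holomorphic_on_imp_differentiable_at by blast
  hence "(g has_field_derivative deriv g (\<phi> z)) (at (W 0 z))"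
    by (simp add: W_def field_differentiable_derivI)
  hence "(\<gamma> has_vector_derivative (\<phi> (x * z) - \<phi> z) * deriv g (\<phi> z)) (at 0)"
    using field_vector_diff_chain_at[OF 1, of g "deriv g (\<phi> z)"] unfolding \<gamma>_def by (simp add: o_def)
  moreover have "eventually (\<lambda>s. cmod (\<gamma> s) \<le> cmod (\<gamma> 0)) (at_right 0)"
    unfolding eventually_at_right_field \<gamma>0 using schwarz by (auto simp: \<gamma>_def intro!: exI[of _ 1])
  ultimately have "Re (cnj z * ((\<phi> (x * z) - \<phi> z) * deriv g (\<phi> z))) \<le> 0"
    using curve_leaving_max_modulus \<gamma>0 by metis
  moreover have "deriv g (\<phi> z) = 1 / deriv \<phi> z"
    using g(2)[OF z(1)] by (metis div_by_0 nonzero_mult_div_cancel_left mult_zero_left zero_neq_one)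
  moreover have "(\<phi> z - \<phi> (x * z)) / (z * deriv \<phi> z)
      = - (cnj z * ((\<phi> (x * z) - \<phi> z) * (1 / deriv \<phi> z))) / of_real ((cmod z)\<^sup>2)"
    using z(2) unfolding complex_norm_square by (simp add: divide_simps)
  ultimately show ?thesis
    by (simp only: Re_divide_of_real uminus_complex.sel) (simp add: divide_nonpos_nonneg)
qed

text \<open>
  A convex function is starlike of order \<open>1/2\<close>. For fixed \<open>z\<close>, the chord quotient \<open>q(x)\<close> maps the disc
  into the right half-plane. Its Cayley transform \<open>B\<close> with \<open>B(0) = 0\<close> obeys \<open>|B(x)| \<le> |x|\<close>, with
  equality at \<open>x = 1\<close> because \<open>q(1) = 0\<close>. Hence \<open>B(x)/x\<close> has maximal modulus at \<open>x = 1\<close>, and its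
  logarithmic derivative there is \<open>2 Re (1/q(0)) - 1\<close>, where \<open>1/q(0) = z \<phi>'(z)/\<phi>(z)\<close>.
\<close>

lemma convex_univalent_starlike_half:
  assumes \<phi>: "\<phi> \<in> convex_univalent" and z: "z \<in> unit_disc" "z \<noteq> 0"
  shows "Re (z * deriv \<phi> z / \<phi> z) \<ge> 1 / 2"
proof -
  note c = convex_univalentD[OF \<phi>]
  have d: "deriv \<phi> z \<noteq> 0" and \<phi>z: "\<phi> z \<noteq> 0"
    using convex_univalent_deriv_nonzero[OF \<phi>] convex_univalent_nonzero[OF \<phi>] z by auto
  define q where "q x = (\<phi> z - \<phi> (x * z)) / (z * deriv \<phi> z)" for x
  have q1: "q 1 = 0" and q0: "q 0 \<noteq> 0" and q0': "1 / q 0 = z * deriv \<phi> z / \<phi> z"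
    using z d \<phi>z c(3) by (auto simp: q_def)
  have scaled: "x * z \<in> unit_disc" if "cmod x \<le> 1" for x
    using mult_right_mono[of "cmod x" 1 "cmod z"] z(1) that by (simp add: norm_mult)
  have hol: "q holomorphic_on ball 0 1"
  proof -
    have "(\<lambda>x. \<phi> (x * z)) holomorphic_on ball 0 1"
      using holomorphic_on_compose_gen[of "\<lambda>x. x * z" unit_disc \<phi> unit_disc] c(1) scaled
      by (simp add: o_def image_subset_iff holomorphic_intros)
    thus ?thesis unfolding q_def using z d by (intro holomorphic_intros) auto
  qed
  have inj: "inj_on q (ball 0 1)"
  proof
    fix x y :: complex assume xy: "x \<in> ball 0 1" "y \<in> ball 0 1" "q x = q y"
    hence "\<phi> (x * z) = \<phi> (y * z)" using z d by (simp add: q_def)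
    thus "x = y" using inj_onD[OF c(2)] scaled[of x] scaled[of y] xy z by fastforce
  qed
  have Re_pos: "Re (q x) > 0" if x: "x \<in> ball 0 1" for x
  proof -
    have "q ` ball 0 1 \<subseteq> {w. Re w \<ge> 0}"
      using convex_univalent_chord[OF \<phi> z] by (auto simp: q_def)
    \<comment> \<open>the image is open, so the boundary line of the half-plane is not reached\<close>
    hence "q ` ball 0 1 \<subseteq> interior {w. Re w \<ge> 0}"
      by (rule interior_maximal) (rule open_mapping_thm3[OF hol open_ball inj])
    also have "interior {w. Re w \<ge> 0} = {w. Re w > 0}"
      using interior_halfspace_ge[of "1::complex" 0] by (simp add: inner_complex_def)
    finally show ?thesis using x by blast
  qed
  define B where "B x = (q x - q 0) / (q x + cnj (q 0))" for x
  have den: "q x + cnj (q 0) \<noteq> 0" if "x \<in> ball 0 1" for x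
    using Re_pos[OF that] Re_pos[of 0] by (auto simp: complex_eq_iff)
  have B_less: "cmod (B x) < 1" if x: "cmod x < 1" for x
  proof -
    have "Re (q x) * Re (q 0) > 0" using Re_pos[of x] Re_pos[of 0] x by simp
    hence "(cmod (q x - q 0))\<^sup>2 < (cmod (q x + cnj (q 0)))\<^sup>2"
      unfolding cmod_power2 by (simp add: power2_eq_square algebra_simps)
    hence "cmod (q x - q 0) < cmod (q x + cnj (q 0))" by (rule power_less_imp_less_base) simp
    thus ?thesis using den[of x] x by (simp add: B_def norm_divide)
  qed
  have hol_B: "B holomorphic_on ball 0 1"
    unfolding B_def[abs_def] by (intro holomorphic_intros hol den)
  have B_le: "cmod (B x) \<le> cmod x" if "cmod x < 1" for x
    by (rule Schwarz_Lemma(1)[OF hol_B]) (use B_less that in \<open>auto simp: B_def\<close>)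
  define \<psi> where "\<psi> x = B x / x" for x
  have \<psi>1: "\<psi> 1 = - q 0 / cnj (q 0)" by (simp add: \<psi>_def B_def q1)
  have "(\<phi> has_field_derivative deriv \<phi> z) (at (1 * z))"
    using holomorphic_derivI[OF c(1) open_ball z(1)] by simp
  hence "((\<lambda>x. \<phi> (x * z)) has_field_derivative deriv \<phi> z * z) (at 1)"
    by (rule DERIV_chain2) (auto intro!: derivative_eq_intros)
  hence "(q has_field_derivative -1) (at 1)"
    unfolding q_def using z d by (auto intro!: derivative_eq_intros simp: divide_simps)
  hence "(\<psi> has_field_derivative
      (((-1) * (cnj (q 0)) - (0 - q 0) * (-1)) / (cnj (q 0) * cnj (q 0)) - (- q 0 / cnj (q 0)))) (at 1)"
    unfolding \<psi>_def B_def using q0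
    by (auto intro!: derivative_eq_intros simp: q1) (simp add: field_simps)
  hence "Re (1 * (((-1) * (cnj (q 0)) - (0 - q 0) * (-1)) / (cnj (q 0) * cnj (q 0)) - (- q 0 / cnj (q 0)))
      / \<psi> 1) \<ge> 0"
  proof (rule log_derivative_at_disc_maximum(2))
    show "\<psi> 1 \<noteq> 0" using q0 by (simp add: \<psi>1)
    show "cmod (\<psi> x) \<le> cmod (\<psi> 1)" if "cmod x < cmod 1" for x
      using B_le[of x] that q0 unfolding \<psi>1 by (auto simp: \<psi>_def norm_divide divide_le_eq_1)
  qed auto
  also have "1 * (((-1) * (cnj (q 0)) - (0 - q 0) * (-1)) / (cnj (q 0) * cnj (q 0)) - (- q 0 / cnj (q 0)))
      / \<psi> 1 = 1 / q 0 + cnj (1 / q 0) - 1"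
    unfolding \<psi>1 using q0 by (simp add: divide_simps)
  also have "Re (1 / q 0 + cnj (1 / q 0) - 1) = 2 * Re (1 / q 0) - 1"
    by (simp only: plus_complex.sel minus_complex.sel one_complex.sel cnj.sel)
  finally show ?thesis by (simp add: q0')
qed

lemma holomorphic_quotient_by_z:
  assumes "\<phi> holomorphic_on unit_disc" "\<phi> 0 = 0"
  shows "(\<lambda>z. if z = 0 then deriv \<phi> 0 else \<phi> z / z) holomorphic_on unit_disc"
  using pole_lemma[OF assms(1), of 0] assms(2) by (simp cong: if_cong)

text \<open>
  The Moebius map \<open>w/(1 - w)\<close> sends the outside of the unit circle to the half-plane to the left of
  \<open>-1/2\<close>, since \<open>2 Re (w/(1 - w)) + 1 = (1 - |w|^2)/|1 - w|^2\<close>.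
\<close>

lemma Re_quotient_outside_unit_disc:
  assumes "cmod w > 1"
  shows "Re (w / (1 - w)) < - 1 / 2"
proof -
  have "w \<noteq> 1" using assms by auto
  have "(cmod w)\<^sup>2 > 1" using assms by (simp add: one_less_power)
  have "w / (1 - w) = w * cnj (1 - w) / of_real ((cmod (1 - w))\<^sup>2)"
    using \<open>w \<noteq> 1\<close> unfolding complex_norm_square by (simp add: divide_simps)
  hence "Re (w / (1 - w)) = Re (w * cnj (1 - w)) / (cmod (1 - w))\<^sup>2"
    by (simp only: Re_divide_of_real)
  moreover have "Re (w * cnj (1 - w)) < - 1 / 2 * (cmod (1 - w))\<^sup>2"
    using \<open>(cmod w)\<^sup>2 > 1\<close> unfolding cmod_power2 by (simp add: power2_eq_square algebra_simps)
  moreover have "(cmod (1 - w))\<^sup>2 > 0" using \<open>w \<noteq> 1\<close> by simp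
  ultimately show ?thesis by (simp only: pos_divide_less_eq)
qed

text \<open>
  Put \<open>\<omega>(z) = 1 - z/\<phi>(z)\<close>, which vanishes at \<open>0\<close>; the claim is equivalent to \<open>|\<omega>| \<le> 1\<close>. If \<open>|\<omega>|\<close>
  exceeded \<open>1\<close> somewhere on a circle, take \<open>z0\<close> on it where \<open>\<omega>(z)/z\<close> has maximal modulus. There
  \<open>z0 \<omega>'(z0) = (1 + L) \<omega>(z0)\<close> with \<open>L \<ge> 0\<close>, so
  \<open>z0 \<phi>'(z0)/\<phi>(z0) = 1 + (1 + L) \<omega>(z0)/(1 - \<omega>(z0))\<close> would have real part below \<open>1/2\<close>.
\<close>

theorem marx_strohhaecker:
  assumes \<phi>: "\<phi> \<in> convex_univalent" and z: "z \<in> unit_disc" "z \<noteq> 0"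
  shows "Re (\<phi> z / z) \<ge> 1 / 2"
proof -
  note c = convex_univalentD[OF \<phi>]
  define U where "U z = (if z = 0 then deriv \<phi> 0 else \<phi> z / z)" for z
  have hol_U: "U holomorphic_on unit_disc"
    using holomorphic_quotient_by_z[OF c(1,3)] by (simp add: U_def[abs_def])
  have U_nz: "U z \<noteq> 0" if "z \<in> unit_disc" for z
    using convex_univalent_nonzero[OF \<phi>] that c(4) by (auto simp: U_def)
  define \<omega> where "\<omega> z = 1 - 1 / U z" for z
  have hol_\<omega>: "\<omega> holomorphic_on unit_disc"
    unfolding \<omega>_def using U_nz by (intro holomorphic_intros hol_U) auto
  have \<omega>0: "\<omega> 0 = 0" by (simp add: \<omega>_def U_def c(4))
  have \<omega>1: "1 - \<omega> z = z / \<phi> z" if "z \<in> unit_disc" "z \<noteq> 0" for z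
    using that by (simp add: \<omega>_def U_def)
  define \<psi> where "\<psi> z = (if z = 0 then deriv \<omega> 0 else \<omega> z / z)" for z
  have hol_\<psi>: "\<psi> holomorphic_on unit_disc"
    using holomorphic_quotient_by_z[OF hol_\<omega> \<omega>0] by (simp add: \<psi>_def[abs_def])
  have \<omega>\<psi>: "\<omega> z = z * \<psi> z" for z using \<omega>0 by (simp add: \<psi>_def)
  have "cmod (\<omega> z) \<le> 1"
  proof (rule ccontr)
    assume gt: "\<not> cmod (\<omega> z) \<le> 1"
    define r where "r = cmod z"
    have r: "0 < r" "r < 1" using z by (auto simp: r_def)
    have sub: "cball 0 r \<subseteq> unit_disc" using r by auto
    have cont: "continuous_on (cball 0 r) \<psi>"
      using holomorphic_on_imp_continuous_on[OF hol_\<psi>] sub continuous_on_subset by blast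
    obtain z0 where z0: "z0 \<in> sphere 0 r" "\<And>y. y \<in> sphere 0 r \<Longrightarrow> cmod (\<psi> y) \<le> cmod (\<psi> z0)"
    proof -
      have "\<exists>x\<in>sphere 0 r. \<forall>y\<in>sphere 0 r. cmod (\<psi> y) \<le> cmod (\<psi> x)"
        using r sphere_cball[of 0 r] cont
        by (intro continuous_attains_sup continuous_on_norm)
          (auto intro: continuous_on_subset)
      thus ?thesis using that by blast
    qed
    have max: "cmod (\<psi> y) \<le> cmod (\<psi> z0)" if "y \<in> cball 0 r" for y
      by (rule maximum_modulus_frontier[where S = "cball 0 r"])
        (use that cont z0 r in \<open>auto intro!: holomorphic_on_subset[OF hol_\<psi>]\<close>)
    have nz: "z0 \<noteq> 0" and z0_disc: "z0 \<in> unit_disc" and z0r: "cmod z0 = r" using z0(1) r by auto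
    have "cmod (\<psi> z) \<le> cmod (\<psi> z0)" using max[of z] by (simp add: r_def)
    hence "cmod (\<omega> z) \<le> cmod (\<omega> z0)"
      unfolding \<omega>\<psi> norm_mult z0r by (simp add: r_def mult_left_mono)
    hence big: "cmod (\<omega> z0) > 1" using gt by simp
    hence nz\<psi>: "\<psi> z0 \<noteq> 0" by (auto simp: \<omega>\<psi>)
    define L where "L = z0 * deriv \<psi> z0 / \<psi> z0"
    have d\<psi>: "(\<psi> has_field_derivative deriv \<psi> z0) (at z0)"
      using holomorphic_derivI[OF hol_\<psi> open_ball z0_disc] .
    have L: "Im L = 0" "Re L \<ge> 0"
      unfolding L_def using log_derivative_at_disc_maximum[OF d\<psi> nz nz\<psi>] max by (auto simp: z0r)
    have \<phi>eq: "\<phi> w = w / (1 - \<omega> w)" if "w \<in> unit_disc - {0}" for w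
      using \<omega>1[of w] that convex_univalent_nonzero[OF \<phi>, of w] by (auto simp: divide_simps mult.commute)
    have nz1: "1 - \<omega> z0 \<noteq> 0" using big by auto
    have "(\<omega> has_field_derivative \<psi> z0 + z0 * deriv \<psi> z0) (at z0)"
      unfolding \<omega>\<psi>[abs_def] by (auto intro!: derivative_eq_intros d\<psi>)
    hence "((\<lambda>w. w / (1 - \<omega> w)) has_field_derivative
        ((1 - \<omega> z0) + z0 * (\<psi> z0 + z0 * deriv \<psi> z0)) / ((1 - \<omega> z0) * (1 - \<omega> z0))) (at z0)"
      using nz1 by (auto intro!: derivative_eq_intros simp: algebra_simps)
    hence "(\<phi> has_field_derivative
        ((1 - \<omega> z0) + z0 * (\<psi> z0 + z0 * deriv \<psi> z0)) / ((1 - \<omega> z0) * (1 - \<omega> z0))) (at z0)"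
      by (rule has_field_derivative_transform_within_open[where S = "unit_disc - {0}"])
        (use nz z0_disc \<phi>eq in auto)
    hence "deriv \<phi> z0 = ((1 - \<omega> z0) + z0 * (\<psi> z0 + z0 * deriv \<psi> z0)) / ((1 - \<omega> z0) * (1 - \<omega> z0))"
      by (rule DERIV_imp_deriv)
    moreover have "z0 * (\<psi> z0 + z0 * deriv \<psi> z0) = \<omega> z0 * (1 + L)"
      unfolding L_def \<omega>\<psi> using nz\<psi> by (simp add: field_simps)
    ultimately have d\<phi>: "deriv \<phi> z0 = ((1 - \<omega> z0) + \<omega> z0 * (1 + L)) / ((1 - \<omega> z0) * (1 - \<omega> z0))"
      by simp
    have "\<phi> z0 = z0 / (1 - \<omega> z0)" using \<phi>eq nz z0_disc by simp
    hence "z0 * deriv \<phi> z0 / \<phi> z0 = 1 + \<omega> z0 / (1 - \<omega> z0) * (1 + L)"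
      unfolding d\<phi> using nz nz1 by (simp add: divide_simps mult.commute)
    hence "1 / 2 \<le> 1 + Re (\<omega> z0 / (1 - \<omega> z0)) * (1 + Re L)"
      using convex_univalent_starlike_half[OF \<phi> z0_disc nz] L(1)
      by (simp only: plus_complex.sel times_complex.sel one_complex.sel) simp
    moreover have "Re (\<omega> z0 / (1 - \<omega> z0)) * (1 + Re L) \<le> Re (\<omega> z0 / (1 - \<omega> z0)) * 1"
      by (rule mult_left_mono_neg) (use L(2) Re_quotient_outside_unit_disc[OF big] in auto)
    ultimately show False using Re_quotient_outside_unit_disc[OF big] by simp
  qed
  moreover have "\<phi> z / z = 1 / (1 - \<omega> z)" using \<omega>1[OF z] by simp
  moreover have "Re (1 / (1 - \<omega> z)) \<ge> 1 / 2" if "cmod (\<omega> z) \<le> 1"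
  proof -
    have nz: "1 - \<omega> z \<noteq> 0" using \<omega>1[OF z] z convex_univalent_nonzero[OF \<phi> z] by simp
    have "(cmod (\<omega> z))\<^sup>2 \<le> 1" using that by (simp add: power_le_one)
    have "1 / (1 - \<omega> z) = cnj (1 - \<omega> z) / of_real ((cmod (1 - \<omega> z))\<^sup>2)"
      using nz unfolding complex_norm_square by (simp add: divide_simps)
    hence "Re (1 / (1 - \<omega> z)) = Re (cnj (1 - \<omega> z)) / (cmod (1 - \<omega> z))\<^sup>2"
      by (simp only: Re_divide_of_real)
    moreover have "1 / 2 * (cmod (1 - \<omega> z))\<^sup>2 \<le> Re (cnj (1 - \<omega> z))"
      using \<open>(cmod (\<omega> z))\<^sup>2 \<le> 1\<close> unfolding cmod_power2 by (simp add: power2_eq_square algebra_simps)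
    moreover have "(cmod (1 - \<omega> z))\<^sup>2 > 0" using nz by simp
    ultimately show ?thesis by (simp only: pos_le_divide_eq)
  qed
  ultimately show ?thesis by simp
qed

section \<open>Coefficientwise products with a kernel of positive real part\<close>

lemma has_integral_character:
  "((\<lambda>t. cis (of_int k * t)) has_integral (if k = 0 then 2 * of_real pi else 0)) {0..2 * pi}"
proof (cases "k = 0")
  case True
  thus ?thesis using has_integral_const_real[of "1::complex" 0 "2 * pi"]
    by (simp add: scaleR_conv_of_real)
next
  case False
  have "((\<lambda>t. cis (of_int k * t)) has_integral
      (cis (of_int k * (2 * pi)) / (\<i> * of_int k) - cis (of_int k * 0) / (\<i> * of_int k))) {0..2 * pi}"
  proof (rule fundamental_theorem_of_calculus)
    fix t :: real
    have "((\<lambda>t. cis (of_int k * t)) has_vector_derivative of_int k * (\<i> * cis (of_int k * t)))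
        (at t within {0..2 * pi})"
      by (auto intro!: derivative_eq_intros simp: has_vector_derivative_def scaleR_conv_of_real)
    from has_vector_derivative_divide[OF this, of "\<i> * of_int k"]
    show "((\<lambda>t. cis (of_int k * t) / (\<i> * of_int k)) has_vector_derivative cis (of_int k * t))
        (at t within {0..2 * pi})"
      using False by simp
  qed simp
  moreover have "cis (of_int k * (2 * pi)) = 1"
    using cis_multiple_2pi[of "of_int k"] by (simp only: Ints_of_int mult.commute)
  ultimately show ?thesis using False by simp
qed

lemma uniform_limit_bounded_series:
  fixes e :: "nat \<Rightarrow> real \<Rightarrow> complex"
  assumes e1: "\<And>n t. cmod (e n t) \<le> 1" and d: "summable (\<lambda>n. cmod (d n))"
  shows "uniform_limit S (\<lambda>N t. \<Sum>n<N. d n * e n t) (\<lambda>t. \<Sum>n. d n * e n t) sequentially"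
  by (rule Weierstrass_m_test[OF _ d]) (simp add: norm_mult mult_left_le e1)

lemma continuous_on_bounded_series:
  fixes e :: "nat \<Rightarrow> real \<Rightarrow> complex"
  assumes e: "\<And>n. continuous_on S (e n)"
    and e1: "\<And>n t. cmod (e n t) \<le> 1" and d: "summable (\<lambda>n. cmod (d n))"
  shows "continuous_on S (\<lambda>t. \<Sum>n. d n * e n t)"
  by (rule uniform_limit_theorem[OF _ uniform_limit_bounded_series[OF e1 d]])
    (auto intro!: always_eventually continuous_on_sum continuous_on_mult continuous_on_const e)

lemma has_integral_mult_series:
  fixes G :: "real \<Rightarrow> complex" and e :: "nat \<Rightarrow> real \<Rightarrow> complex"
  assumes G: "continuous_on {a..b} G" and e: "\<And>n. continuous_on {a..b} (e n)"
    and e1: "\<And>n t. cmod (e n t) \<le> 1" and d: "summable (\<lambda>n. cmod (d n))"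
    and I: "\<And>n. ((\<lambda>t. G t * e n t) has_integral I n) {a..b}"
  shows "((\<lambda>t. G t * (\<Sum>n. d n * e n t)) has_integral (\<Sum>n. d n * I n)) {a..b}"
proof -
  have "bounded (G ` {a..b})"
    using G by (intro compact_imp_bounded compact_continuous_image) auto
  moreover have "bounded ((\<lambda>t. \<Sum>n. d n * e n t) ` {a..b})"
    using continuous_on_bounded_series[OF e e1 d]
    by (intro compact_imp_bounded compact_continuous_image) auto
  ultimately have unif: "uniform_limit {a..b} (\<lambda>N t. G t * (\<Sum>n<N. d n * e n t))
      (\<lambda>t. G t * (\<Sum>n. d n * e n t)) sequentially"
    by (intro uniform_lim_mult[OF uniform_limit_const uniform_limit_bounded_series[OF e1 d]])
  have cont: "continuous_on {a..b} (\<lambda>t. G t * (\<Sum>n<N. d n * e n t))" for N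
    by (intro continuous_on_sum continuous_on_mult continuous_on_const e G)
  obtain J K where JK: "\<And>N. ((\<lambda>t. G t * (\<Sum>n<N. d n * e n t)) has_integral J N) {a..b}"
      "((\<lambda>t. G t * (\<Sum>n. d n * e n t)) has_integral K) {a..b}" "J \<longlonglongrightarrow> K"
    by (rule uniform_limit_integral[OF unif cont sequentially_bot]) (rule that)
  have "J N = (\<Sum>n<N. d n * I n)" for N
  proof (rule has_integral_unique[OF JK(1)])
    have "((\<lambda>t. \<Sum>n<N. d n * (G t * e n t)) has_integral (\<Sum>n<N. d n * I n)) {a..b}"
      by (rule has_integral_sum) (simp, rule has_integral_mult_right[OF I])
    thus "((\<lambda>t. G t * (\<Sum>n<N. d n * e n t)) has_integral (\<Sum>n<N. d n * I n)) {a..b}"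
      by (simp add: sum_distrib_left mult.left_commute)
  qed
  hence "J = (\<lambda>N. \<Sum>n<N. d n * I n)" by (rule ext)
  hence "(\<lambda>n. d n * I n) sums K" using JK(3) by (simp add: sums_def)
  thus ?thesis using JK(2) by (simp add: sums_iff)
qed

text \<open>
  The frequencies \<open>k m\<close> are left general because two cases are needed: \<open>k m = m\<close>, where the integral
  pairs equal indices, and \<open>k m = -m\<close> (the conjugate series), where only the constant terms meet.
\<close>

lemma has_integral_Fourier_product:
  fixes c d :: "nat \<Rightarrow> complex" and k :: "nat \<Rightarrow> int"
  assumes c: "summable (\<lambda>n. cmod (c n))" and d: "summable (\<lambda>n. cmod (d n))"
    and S: "\<And>n. (\<lambda>m. if k m = int n then c m else 0) sums S n"
  shows "((\<lambda>t. (\<Sum>m. c m * cis (of_int (k m) * t)) * (\<Sum>n. d n * cis (of_int (- int n) * t)))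
      has_integral (\<Sum>n. d n * (2 * of_real pi * S n))) {0..2 * pi}"
proof -
  let ?e = "\<lambda>(k::int) (t::real). cis (of_int k * t)"
  have cont: "continuous_on {0..2 * pi} (?e k)" for k by (intro continuous_intros)
  define C where "C t = (\<Sum>m. c m * ?e (k m) t)" for t
  have C_cont: "continuous_on {0..2 * pi} C"
    unfolding C_def
    by (rule continuous_on_bounded_series[OF cont _ c]) simp
  have C_int: "((\<lambda>t. C t * ?e (- int n) t) has_integral 2 * of_real pi * S n) {0..2 * pi}" for n
  proof -
    have "((\<lambda>t. ?e (- int n) t * C t) has_integral
        (\<Sum>m. c m * (if k m - int n = 0 then 2 * of_real pi else 0))) {0..2 * pi}"
      unfolding C_def
    proof (rule has_integral_mult_series[OF cont cont _ c])
      fix m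
      have "?e (- int n) t * ?e (k m) t = ?e (k m - int n) t" for t
        by (simp add: cis_mult algebra_simps)
      thus "((\<lambda>t. ?e (- int n) t * ?e (k m) t) has_integral
          (if k m - int n = 0 then 2 * of_real pi else 0)) {0..2 * pi}"
        using has_integral_character[of "k m - int n"] by simp
    qed simp
    moreover have "(\<lambda>m. c m * (if k m - int n = 0 then 2 * of_real pi else 0)) sums
        (2 * of_real pi * S n)"
    proof -
      have "(\<lambda>m. c m * (if k m - int n = 0 then 2 * of_real pi else 0))
          = (\<lambda>m. 2 * of_real pi * (if k m = int n then c m else 0))" by auto
      thus ?thesis using sums_mult[OF S, of "2 * of_real pi" n] by simp
    qed
    ultimately show ?thesis by (simp add: sums_iff mult.commute)
  qed
  show ?thesis
    using has_integral_mult_series[OF C_cont cont _ d C_int] by (simp add: C_def)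
qed

lemma summable_norm_mult:
  fixes a b :: "nat \<Rightarrow> complex"
  assumes a: "summable (\<lambda>n. cmod (a n))" and b: "summable (\<lambda>n. cmod (b n))"
  shows "summable (\<lambda>n. cmod (a n * b n))"
proof -
  have "b \<longlonglongrightarrow> 0" using summable_LIMSEQ_zero[OF b] by (simp add: tendsto_norm_zero_iff)
  hence "Bseq b" by (intro convergent_imp_Bseq) (auto simp: convergent_def)
  then obtain K where K: "\<And>n. cmod (b n) \<le> K" by (auto simp: Bseq_def)
  show ?thesis
    by (rule summable_comparison_test'[OF summable_mult2[OF a, of K]])
      (simp add: norm_mult mult_left_mono K)
qed

text \<open>
  Let \<open>C(t)\<close> and \<open>D(t)\<close> be the sums of the two power series at \<open>exp(it)\<close> and \<open>exp(-it)\<close>. Then \<open>\<Sum> c n d n\<close>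
  is the mean of \<open>C D\<close>. The means of \<open>cnj C D\<close> and of \<open>D\<close> vanish, as \<open>d 0 = 0\<close>, so it is also the mean
  of \<open>(2 Re C - 1) D\<close>, whose first factor is nonnegative with mean \<open>1\<close>.
\<close>

lemma hadamard_sum_bound:
  fixes c d :: "nat \<Rightarrow> complex"
  assumes c: "summable (\<lambda>n. cmod (c n))" "c 0 = 1" and d: "summable (\<lambda>n. cmod (d n))" "d 0 = 0"
    and Re: "\<And>w. cmod w = 1 \<Longrightarrow> Re (\<Sum>n. c n * w ^ n) \<ge> 1 / 2"
    and M: "\<And>w. cmod w = 1 \<Longrightarrow> cmod (\<Sum>n. d n * w ^ n) \<le> M"
  shows "cmod (\<Sum>n. c n * d n) \<le> M"
proof -
  define C where "C t = (\<Sum>m. c m * cis (of_int (int m) * t))" for t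
  define C' where "C' t = (\<Sum>m. cnj (c m) * cis (of_int (- int m) * t))" for t
  define D where "D t = (\<Sum>n. d n * cis (of_int (- int n) * t))" for t
  have C'C: "C' t = cnj (C t)" for t
  proof -
    have "summable (\<lambda>m. c m * cis (of_int (int m) * t))"
      by (rule summable_norm_cancel) (use c(1) in \<open>simp add: norm_mult\<close>)
    hence "(\<lambda>m. cnj (c m * cis (of_int (int m) * t))) sums cnj (C t)"
      unfolding C_def by (intro sums_cnj[THEN iffD2] summable_sums)
    thus ?thesis unfolding C'_def by (simp add: sums_iff cis_cnj)
  qed
  have CD: "((\<lambda>t. C t * D t) has_integral 2 * of_real pi * (\<Sum>n. c n * d n)) {0..2 * pi}"
  proof -
    have "summable (\<lambda>n. d n * c n)"
      using summable_norm_mult[OF d(1) c(1)] by (rule summable_norm_cancel)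
    hence "(\<Sum>n. d n * (2 * of_real pi * c n)) = 2 * of_real pi * (\<Sum>n. c n * d n)"
      using suminf_mult[of "\<lambda>n. d n * c n" "2 * of_real pi"] by (simp add: mult.left_commute mult.commute)
    moreover have "(\<lambda>m. if int m = int n then c m else 0) sums c n" for n
      using sums_single[of n c] by simp
    ultimately show ?thesis
      unfolding C_def D_def using has_integral_Fourier_product[OF c(1) d(1), of int c] by simp
  qed
  have C'D: "((\<lambda>t. C' t * D t) has_integral 0) {0..2 * pi}"
  proof -
    have "(\<lambda>m. if - int m = int n then cnj (c m) else 0) sums (if n = 0 then cnj (c 0) else 0)" for n
    proof -
      have "(\<lambda>m. if - int m = int n then cnj (c m) else 0)
          = (\<lambda>m. if m = 0 then (if n = 0 then cnj (c m) else 0) else 0)" by (auto simp: fun_eq_iff)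
      thus ?thesis using sums_single[of 0 "\<lambda>m. if n = 0 then cnj (c m) else 0"] by simp
    qed
    from has_integral_Fourier_product[OF _ d(1) this] c(1)
    have "((\<lambda>t. C' t * D t) has_integral
        (\<Sum>n. d n * (2 * of_real pi * (if n = 0 then cnj (c 0) else 0)))) {0..2 * pi}"
      unfolding C'_def D_def by simp
    also have "(\<lambda>n. d n * (2 * of_real pi * (if n = 0 then cnj (c 0) else 0))) = (\<lambda>n. 0)"
      using d(2) by auto
    finally show ?thesis by simp
  qed
  have series_integral: "((\<lambda>t. \<Sum>n. a n * cis (of_int (s * int n) * t)) has_integral
      a 0 * (2 * of_real pi)) {0..2 * pi}"
    if a: "summable (\<lambda>n. cmod (a n))" and "s \<noteq> 0" for a s
  proof -
    have I: "((\<lambda>t. 1 * cis (of_int (s * int n) * t)) has_integral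
        (if n = 0 then 2 * of_real pi else 0)) {0..2 * pi}" for n
      using has_integral_character[of "s * int n"] \<open>s \<noteq> 0\<close> by simp
    have "((\<lambda>t. 1 * (\<Sum>n. a n * cis (of_int (s * int n) * t))) has_integral
        (\<Sum>n. a n * (if n = 0 then 2 * of_real pi else 0))) {0..2 * pi}"
      by (rule has_integral_mult_series[OF _ _ _ a I]) (auto intro!: continuous_intros)
    moreover have "(\<lambda>n. a n * (if n = 0 then 2 * of_real pi else 0)) sums (a 0 * (2 * of_real pi))"
      using sums_single[of 0 "\<lambda>n. a n * (2 * of_real pi)"] by (simp add: if_distrib cong: if_cong)
    ultimately show ?thesis by (simp add: sums_iff)
  qed
  have D: "(D has_integral 0) {0..2 * pi}"
    using series_integral[OF d(1), of "-1"] d(2) by (simp add: D_def[abs_def])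
  have C: "(C has_integral 2 * of_real pi) {0..2 * pi}"
    using series_integral[OF c(1), of 1] c(2) by (simp add: C_def[abs_def])
  define K where "K t = 2 * Re (C t) - 1" for t
  have "((\<lambda>t. Re (C t)) has_integral 2 * pi) {0..2 * pi}"
    using has_integral_linear[OF C bounded_linear_Re] by (simp add: o_def)
  from has_integral_diff[OF has_integral_mult_right[OF this, of 2] has_integral_const_real[of 1 0 "2 * pi"]]
  have K: "(K has_integral 2 * pi) {0..2 * pi}" by (simp add: K_def[abs_def])
  have K0: "K t \<ge> 0" for t
  proof -
    have "C t = (\<Sum>n. c n * cis t ^ n)" by (simp add: C_def Complex.DeMoivre)
    thus ?thesis using Re[of "cis t"] by (simp add: K_def)
  qed
  have DM: "cmod (D t) \<le> M" for t
  proof -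
    have "D t = (\<Sum>n. d n * cis (- t) ^ n)" by (simp add: D_def Complex.DeMoivre)
    thus ?thesis using M[of "cis (- t)"] by simp
  qed
  have "((\<lambda>t. C t * D t + C' t * D t - D t) has_integral
      2 * of_real pi * (\<Sum>n. c n * d n) + 0 - 0) {0..2 * pi}"
    by (intro has_integral_diff has_integral_add CD C'D D)
  moreover have "C t * D t + C' t * D t - D t = of_real (K t) * D t" for t
    unfolding C'C K_def by (simp add: complex_eq_iff algebra_simps)
  ultimately have KD: "((\<lambda>t. of_real (K t) * D t) has_integral 2 * of_real pi * (\<Sum>n. c n * d n)) {0..2 * pi}"
    by simp
  have "cmod (2 * of_real pi * (\<Sum>n. c n * d n)) \<le> M * (2 * pi)"
  proof -
    have KM: "((\<lambda>t. M * K t) has_integral M * (2 * pi)) {0..2 * pi}"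
      by (rule has_integral_mult_right[OF K])
    have "cmod (of_real (K t) * D t) \<le> M * K t" for t
      using K0[of t] mult_right_mono[OF DM[of t] K0[of t]] by (simp add: norm_mult mult.commute)
    thus ?thesis
      using Henstock_Kurzweil_Integration.integral_norm_bound_integral[OF
          has_integral_integrable[OF KD] has_integral_integrable[OF KM]]
      by (simp only: integral_unique[OF KD] integral_unique[OF KM])
  qed
  thus ?thesis by (simp add: norm_mult)
qed

section \<open>Harmonic functions as sums of holomorphic and antiholomorphic functions\<close>

text \<open>
  The formulas for the two partial derivatives have again the form of a holomorphic function plus the
  conjugate of one, so they can be iterated.
\<close>

lemma holomorphic_plus_cnj_derivs:
  assumes h: "h holomorphic_on S" and g: "g holomorphic_on S" and S: "open S" "z \<in> S"
    and f: "\<And>w. w \<in> S \<Longrightarrow> f w = h w + cnj (g w)"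
  shows "(f has_derivative (\<lambda>v. deriv h z * v + cnj (deriv g z * v))) (at z)"
    and "partial_x f z = deriv h z + cnj (deriv g z)"
    and "partial_y f z = \<i> * deriv h z + cnj (\<i> * deriv g z)"
    and "deriv_z f z = deriv h z" and "deriv_zbar f z = cnj (deriv g z)"
proof -
  have "(h has_derivative (*) (deriv h z)) (at z)" "(g has_derivative (*) (deriv g z)) (at z)"
    using holomorphic_derivI[OF h S] holomorphic_derivI[OF g S]
    by (simp_all add: has_field_derivative_def)
  hence "((\<lambda>w. h w + cnj (g w)) has_derivative (\<lambda>v. deriv h z * v + cnj (deriv g z * v))) (at z)"
    by (intro has_derivative_add bounded_linear.has_derivative[OF bounded_linear_cnj])
  thus *: "(f has_derivative (\<lambda>v. deriv h z * v + cnj (deriv g z * v))) (at z)"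
    by (rule has_derivative_transform_within_open[OF _ S]) (simp add: f)
  show x: "partial_x f z = deriv h z + cnj (deriv g z)"
    and y: "partial_y f z = \<i> * deriv h z + cnj (\<i> * deriv g z)"
    unfolding partial_x_def partial_y_def frechet_derivative_at[OF *, symmetric]
    by (simp_all add: mult.commute)
  show "deriv_z f z = deriv h z" and "deriv_zbar f z = cnj (deriv g z)"
    unfolding deriv_z_def deriv_zbar_def x y by (simp_all add: field_simps)
qed

lemma holomorphic_plus_cnj_regular:
  assumes "h holomorphic_on S" "g holomorphic_on S" "open S"
    and "\<And>w. w \<in> S \<Longrightarrow> f w = h w + cnj (g w)"
  shows "f differentiable_on S" and "continuous_on S f"
proof -
  show "f differentiable_on S"
    unfolding differentiable_on_def
    using holomorphic_plus_cnj_derivs(1)[OF assms(1-3) _ assms(4)]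
    by (meson differentiableI differentiable_at_withinI)
  thus "continuous_on S f" by (rule differentiable_imp_continuous_on)
qed

lemma harmonic_on_holomorphic_plus_cnj:
  assumes h: "h holomorphic_on S" and g: "g holomorphic_on S" and S: "open S"
    and f: "\<And>w. w \<in> S \<Longrightarrow> f w = h w + cnj (g w)"
  shows "harmonic_on f S"
proof -
  note D = holomorphic_plus_cnj_derivs and R = holomorphic_plus_cnj_regular
  have h1: "deriv h holomorphic_on S" and g1: "deriv g holomorphic_on S"
    using h g S by (auto intro: holomorphic_deriv)
  have h1': "(\<lambda>w. \<i> * deriv h w) holomorphic_on S" and g1': "(\<lambda>w. \<i> * deriv g w) holomorphic_on S"
    using h1 g1 by (auto intro!: holomorphic_intros)
  have h2: "deriv (deriv h) holomorphic_on S" and g2: "deriv (deriv g) holomorphic_on S"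
    using h1 g1 S by (auto intro: holomorphic_deriv)
  have h2': "(\<lambda>w. c * deriv (deriv h) w) holomorphic_on S"
    and g2': "(\<lambda>w. c * deriv (deriv g) w) holomorphic_on S" for c
    using h2 g2 by (auto intro!: holomorphic_intros)
  note x = D(2)[OF h g S _ f] and y = D(3)[OF h g S _ f]
  have di: "deriv (\<lambda>w. \<i> * deriv h w) w = \<i> * deriv (deriv h) w"
    "deriv (\<lambda>w. \<i> * deriv g w) w = \<i> * deriv (deriv g) w" if "w \<in> S" for w
    using that h1 g1 S by (auto intro!: deriv_cmult holomorphic_on_imp_differentiable_at)
  have xx: "partial_x (partial_x f) w = deriv (deriv h) w + cnj (deriv (deriv g) w)"
    and yx: "partial_y (partial_x f) w = \<i> * deriv (deriv h) w + cnj (\<i> * deriv (deriv g) w)"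
    and xy: "partial_x (partial_y f) w = \<i> * deriv (deriv h) w + cnj (\<i> * deriv (deriv g) w)"
    and yy: "partial_y (partial_y f) w = (-1) * deriv (deriv h) w + cnj ((-1) * deriv (deriv g) w)"
    if w: "w \<in> S" for w
  proof -
    show "partial_x (partial_x f) w = deriv (deriv h) w + cnj (deriv (deriv g) w)"
      by (rule D(2)[OF h1 g1 S w x])
    show "partial_y (partial_x f) w = \<i> * deriv (deriv h) w + cnj (\<i> * deriv (deriv g) w)"
      by (rule D(3)[OF h1 g1 S w x])
    show "partial_x (partial_y f) w = \<i> * deriv (deriv h) w + cnj (\<i> * deriv (deriv g) w)"
      using D(2)[OF h1' g1' S w y] by (simp add: di[OF w])
    show "partial_y (partial_y f) w = (-1) * deriv (deriv h) w + cnj ((-1) * deriv (deriv g) w)"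
      using D(3)[OF h1' g1' S w y] by (simp add: di[OF w])
  qed
  show ?thesis
    unfolding harmonic_on_def
  proof (intro conjI ballI)
    show "partial_x (partial_x f) z + partial_y (partial_y f) z = 0" if "z \<in> S" for z
      using xx[OF that] yy[OF that] by simp
  qed (rule R(1)[OF h g S f] R(1)[OF h1 g1 S x] R(1)[OF h1' g1' S y]
      R(2)[OF h2 g2 S xx] R(2)[OF h2' g2' S yx] R(2)[OF h2' g2' S xy] R(2)[OF h2' g2' S yy]; assumption)+
qed

text \<open>
  Increment first in direction \<open>v\<close> and then regard the difference as a function of the \<open>u\<close>-step: its
  derivative is the increment of \<open>f' w u\<close> over \<open>t v\<close>, which is \<open>t A v\<close> up to \<open>o(t)\<close>, and the mean value
  inequality integrates this over a step of length \<open>t\<close>.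
\<close>

lemma second_difference_quotient:
  fixes f :: "'a::real_normed_vector \<Rightarrow> 'b::real_normed_vector"
  assumes S: "open S" "z \<in> S" and f: "\<And>w. w \<in> S \<Longrightarrow> (f has_derivative f' w) (at w)"
    and A: "((\<lambda>w. f' w u) has_derivative A) (at z)"
  shows "((\<lambda>t. (f (z + t *\<^sub>R u + t *\<^sub>R v) - f (z + t *\<^sub>R u) - f (z + t *\<^sub>R v) + f z) /\<^sub>R t\<^sup>2)
    \<longlongrightarrow> A v) (at_right 0)"
proof (rule tendstoI)
  fix e :: real assume e: "e > 0"
  define N where "N = norm u + norm v + 1"
  have N: "N > 0" by (simp add: N_def add_nonneg_pos)
  \<comment> \<open>two increments of size at most \<open>t N\<close> together contribute \<open>e t / 2\<close>, leaving room for strictness\<close>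
  define e' where "e' = e / (4 * N)"
  have "e' > 0" using e N by (simp add: e'_def)
  then obtain d where d: "d > 0" "\<And>y. norm (y - z) < d \<Longrightarrow>
      norm (f' y u - f' z u - A (y - z)) \<le> e' * norm (y - z)"
    using A unfolding has_derivative_at_alt by blast
  obtain r where r: "r > 0" "ball z r \<subseteq> S" using S open_contains_ball by blast
  define b where "b = min d r / N"
  have b: "b > 0" using d(1) r(1) N by (simp add: b_def)
  have linA: "bounded_linear A" using A by (rule has_derivative_bounded_linear)
  have bound: "dist ((f (z + t *\<^sub>R u + t *\<^sub>R v) - f (z + t *\<^sub>R u) - f (z + t *\<^sub>R v) + f z) /\<^sub>R t\<^sup>2) (A v) < e"
    if t: "0 < t" "t < b" for t
  proof -
    have near: "norm (s *\<^sub>R u + s' *\<^sub>R v) \<le> t * N" "t * N < d" "t * N < r"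
      if "s \<in> {0..t}" "s' \<in> {0..t}" for s s'
    proof -
      have "norm (s *\<^sub>R u + s' *\<^sub>R v) \<le> s * norm u + s' * norm v"
        using norm_triangle_ineq[of "s *\<^sub>R u" "s' *\<^sub>R v"] that by simp
      also have "\<dots> \<le> t * norm u + t * norm v"
        using that by (intro add_mono mult_right_mono) auto
      also have "\<dots> \<le> t * N" using t by (simp add: N_def algebra_simps)
      finally show "norm (s *\<^sub>R u + s' *\<^sub>R v) \<le> t * N" .
      show "t * N < d" "t * N < r" using t N by (auto simp: b_def pos_less_divide_eq)
    qed
    define g where "g s = f (z + s *\<^sub>R u + t *\<^sub>R v) - f (z + s *\<^sub>R u) - s *\<^sub>R (t *\<^sub>R A v)" for s
    define g' where "g' s = f' (z + s *\<^sub>R u + t *\<^sub>R v) u - f' (z + s *\<^sub>R u) u - t *\<^sub>R A v" for s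
    have inS: "z + s *\<^sub>R u + s' *\<^sub>R v \<in> S" if "s \<in> {0..t}" "s' \<in> {0..t}" for s s'
    proof -
      have "dist z (z + (s *\<^sub>R u + s' *\<^sub>R v)) = norm (s *\<^sub>R u + s' *\<^sub>R v)"
        by (metis add_diff_cancel_left' dist_norm norm_minus_commute)
      hence "z + (s *\<^sub>R u + s' *\<^sub>R v) \<in> ball z r"
        using near(1,3)[OF that] by simp
      thus ?thesis using r(2) by (auto simp: add.assoc)
    qed
    have der: "(g has_derivative (\<lambda>h. h *\<^sub>R g' s)) (at s within {0..t})" if s: "s \<in> {0..t}" for s
    proof -
      have 1: "((\<lambda>s. z + s *\<^sub>R u + s' *\<^sub>R v) has_derivative (\<lambda>h. h *\<^sub>R u)) (at s within {0..t})" for s'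
        by (auto intro!: derivative_eq_intros)
      have 2: "((\<lambda>s. f (z + s *\<^sub>R u + s' *\<^sub>R v)) has_derivative (\<lambda>h. h *\<^sub>R f' (z + s *\<^sub>R u + s' *\<^sub>R v) u))
          (at s within {0..t})" if "s' \<in> {0..t}" for s'
      proof -
        have fd: "(f has_derivative f' (z + s *\<^sub>R u + s' *\<^sub>R v)) (at (z + s *\<^sub>R u + s' *\<^sub>R v))"
          by (rule f[OF inS[OF s that]])
        have "((\<lambda>s. f (z + s *\<^sub>R u + s' *\<^sub>R v)) has_derivative
            (\<lambda>h. f' (z + s *\<^sub>R u + s' *\<^sub>R v) (h *\<^sub>R u))) (at s within {0..t})"
          by (rule has_derivative_compose[OF 1 fd])
        thus ?thesis
          using linear_scale[OF has_derivative_linear[OF fd]] by simp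
      qed
      have "(g has_derivative (\<lambda>h. h *\<^sub>R f' (z + s *\<^sub>R u + t *\<^sub>R v) u - h *\<^sub>R f' (z + s *\<^sub>R u + 0 *\<^sub>R v) u
          - h *\<^sub>R (t *\<^sub>R A v))) (at s within {0..t})"
        unfolding g_def using 2[of 0] 2[of t] t
        by (intro has_derivative_diff has_derivative_scaleR_left has_derivative_ident) auto
      thus ?thesis by (simp add: g'_def scaleR_diff_right)
    qed
    have "norm (g' s) \<le> e / 2 * t" if s: "s \<in> {0..t}" for s
    proof -
      have *: "norm (f' (z + s *\<^sub>R u + s' *\<^sub>R v) u - f' z u - A (s *\<^sub>R u + s' *\<^sub>R v)) \<le> e' * (t * N)"
        if s': "s' \<in> {0..t}" for s'
      proof -
        have "norm (f' (z + (s *\<^sub>R u + s' *\<^sub>R v)) u - f' z u - A (s *\<^sub>R u + s' *\<^sub>R v))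
            \<le> e' * norm (s *\<^sub>R u + s' *\<^sub>R v)"
          using d(2)[of "z + (s *\<^sub>R u + s' *\<^sub>R v)"] near[OF s s'] by auto
        also have "\<dots> \<le> e' * (t * N)"
          using near(1)[OF s s'] \<open>e' > 0\<close> by (intro mult_left_mono) auto
        finally show ?thesis by (simp add: add.assoc)
      qed
      have "g' s = (f' (z + s *\<^sub>R u + t *\<^sub>R v) u - f' z u - A (s *\<^sub>R u + t *\<^sub>R v))
          - (f' (z + s *\<^sub>R u + 0 *\<^sub>R v) u - f' z u - A (s *\<^sub>R u + 0 *\<^sub>R v))"
        using linA by (simp add: g'_def linear_add linear_scale bounded_linear.linear)
      also have "norm \<dots> \<le> e' * (t * N) + e' * (t * N)"
        by (rule order_trans[OF norm_triangle_ineq4 add_mono[OF * *]]) (use t in auto)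
      also have "\<dots> = e / 2 * t" using N by (simp add: e'_def field_simps)
      finally show ?thesis .
    qed
    hence on: "onorm (\<lambda>h. h *\<^sub>R g' s) \<le> e / 2 * t" if "s \<in> {0..t}" for s
      using that by (intro onorm_le) (simp only: norm_scaleR mult.commute real_norm_def, rule mult_left_mono, auto)
    have "norm (g t - g 0) \<le> e / 2 * t * norm (t - 0)"
      by (rule differentiable_bound[OF _ der on]) (use t in auto)
    hence "norm (g t - g 0) \<le> e / 2 * t\<^sup>2" using t by (simp add: power2_eq_square)
    moreover have "(f (z + t *\<^sub>R u + t *\<^sub>R v) - f (z + t *\<^sub>R u) - f (z + t *\<^sub>R v) + f z) /\<^sub>R t\<^sup>2 - A v
        = (g t - g 0) /\<^sub>R t\<^sup>2"
    proof -
      have "g t - g 0 = (f (z + t *\<^sub>R u + t *\<^sub>R v) - f (z + t *\<^sub>R u) - f (z + t *\<^sub>R v) + f z) - t\<^sup>2 *\<^sub>R A v"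
        by (simp add: g_def power2_eq_square)
      thus ?thesis using t by (simp add: scaleR_diff_right)
    qed
    moreover have "norm ((g t - g 0) /\<^sub>R t\<^sup>2) \<le> e / 2" if "norm (g t - g 0) \<le> e / 2 * t\<^sup>2"
    proof -
      have "norm ((g t - g 0) /\<^sub>R t\<^sup>2) = inverse (t\<^sup>2) * norm (g t - g 0)"
        by (simp only: norm_scaleR abs_inverse abs_power2)
      also have "\<dots> \<le> inverse (t\<^sup>2) * (e / 2 * t\<^sup>2)"
        by (rule mult_left_mono[OF that]) simp
      also have "\<dots> = e / 2" using t by simp
      finally show ?thesis .
    qed
    ultimately have "dist ((f (z + t *\<^sub>R u + t *\<^sub>R v) - f (z + t *\<^sub>R u) - f (z + t *\<^sub>R v) + f z) /\<^sub>R t\<^sup>2) (A v) \<le> e / 2"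
      by (simp only: dist_norm)
    thus ?thesis using e by simp
  qed
  show "eventually (\<lambda>t. dist ((f (z + t *\<^sub>R u + t *\<^sub>R v) - f (z + t *\<^sub>R u) - f (z + t *\<^sub>R v) + f z) /\<^sub>R t\<^sup>2) (A v) < e) (at_right 0)"
    unfolding eventually_at_right_field using b bound by blast
qed

text \<open>
  Young's theorem: the second difference quotient is symmetric in \<open>u\<close> and \<open>v\<close>, so its two limits agree.
\<close>

lemma mixed_derivatives_commute:
  fixes f :: "'a::real_normed_vector \<Rightarrow> 'b::real_normed_vector"
  assumes "open S" "z \<in> S" "\<And>w. w \<in> S \<Longrightarrow> (f has_derivative f' w) (at w)"
    and "((\<lambda>w. f' w u) has_derivative A) (at z)" "((\<lambda>w. f' w v) has_derivative B) (at z)"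
  shows "A v = B u"
proof (rule tendsto_unique)
  show "((\<lambda>t. (f (z + t *\<^sub>R u + t *\<^sub>R v) - f (z + t *\<^sub>R u) - f (z + t *\<^sub>R v) + f z) /\<^sub>R t\<^sup>2)
    \<longlongrightarrow> A v) (at_right 0)"
    by (rule second_difference_quotient[OF assms(1-4)])
  show "((\<lambda>t. (f (z + t *\<^sub>R u + t *\<^sub>R v) - f (z + t *\<^sub>R u) - f (z + t *\<^sub>R v) + f z) /\<^sub>R t\<^sup>2)
    \<longlongrightarrow> B u) (at_right 0)"
    using second_difference_quotient[OF assms(1-3,5), of u]
    by (simp add: add.assoc add.commute add.left_commute diff_diff_eq)
qed simp

lemma real_linear_complex:
  fixes L :: "complex \<Rightarrow> complex"
  assumes "linear L"
  shows "L v = of_real (Re v) * L 1 + of_real (Im v) * L \<i>"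
proof -
  have "v = Re v *\<^sub>R 1 + Im v *\<^sub>R \<i>" by (simp add: complex_eq_iff)
  hence "L v = L (Re v *\<^sub>R 1 + Im v *\<^sub>R \<i>)" by (rule arg_cong)
  also have "\<dots> = Re v *\<^sub>R L 1 + Im v *\<^sub>R L \<i>"
    by (simp only: linear_add[OF assms] linear_scale[OF assms])
  finally show ?thesis by (simp only: scaleR_conv_of_real)
qed

text \<open>
  By the Laplace equation and the symmetry of the mixed derivatives, the real derivative of
  \<open>deriv_z f\<close> is complex linear, so \<open>deriv_z f\<close> is holomorphic and has a primitive \<open>h\<close> on the disc. The derivative of
  \<open>f - h\<close> is then conjugate linear, so \<open>cnj (f - h)\<close> is holomorphic.
\<close>

lemma harmonic_imp_canonical_decomp:
  assumes f: "harmonic_on f unit_disc" and f0: "f 0 = 0"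
  obtains h g where "canonical_decomp f h g"
proof -
  have diff: "(F has_derivative frechet_derivative F (at z)) (at z)"
    if "F differentiable_on unit_disc" "z \<in> unit_disc" for F :: "complex \<Rightarrow> complex" and z
    using that differentiable_on_eq_differentiable_at[OF open_ball] frechet_derivative_works by blast
  define f' where "f' z = frechet_derivative f (at z)" for z
  have f': "(f has_derivative f' z) (at z)" if "z \<in> unit_disc" for z
    using diff[of f z] f that by (simp add: harmonic_on_def f'_def)
  have fx: "(partial_x f has_derivative frechet_derivative (partial_x f) (at z)) (at z)"
    and fy: "(partial_y f has_derivative frechet_derivative (partial_y f) (at z)) (at z)"
    if "z \<in> unit_disc" for z
    using diff f that by (simp_all add: harmonic_on_def)
  have p: "\<exists>p'. (deriv_z f has_field_derivative p') (at z)" if z: "z \<in> unit_disc" for z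
  proof -
    define A where "A = frechet_derivative (partial_x f) (at z)"
    define B where "B = frechet_derivative (partial_y f) (at z)"
    have A: "((\<lambda>w. f' w 1) has_derivative A) (at z)" and B: "((\<lambda>w. f' w \<i>) has_derivative B) (at z)"
    proof -
      have eq: "(\<lambda>w. f' w 1) = partial_x f" "(\<lambda>w. f' w \<i>) = partial_y f"
        by (simp_all add: fun_eq_iff f'_def partial_x_def partial_y_def)
      show "((\<lambda>w. f' w 1) has_derivative A) (at z)" "((\<lambda>w. f' w \<i>) has_derivative B) (at z)"
        unfolding eq A_def B_def by (rule fx[OF z], rule fy[OF z])
    qed
    have AB: "A \<i> = B 1" by (rule mixed_derivatives_commute[OF open_ball z f' A B])
    have laplace: "B \<i> = - A 1"
      using f z unfolding harmonic_on_def
      by (simp add: A_def B_def partial_x_def[of "partial_x f"] partial_y_def[of "partial_y f"] add_eq_0_iff)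
    have "(deriv_z f has_derivative (\<lambda>v. (A v - \<i> * B v) / 2)) (at z)"
      unfolding deriv_z_def[abs_def] partial_x_def partial_y_def f'_def[symmetric]
      by (rule bounded_linear.has_derivative[OF bounded_linear_divide
            has_derivative_diff[OF A has_derivative_mult_right[OF B]]])
    also have "(\<lambda>v. (A v - \<i> * B v) / 2) = (*) ((A 1 - \<i> * B 1) / 2)"
    proof
      fix v
      have v: "v = of_real (Re v) + \<i> * of_real (Im v)" by (simp add: complex_eq_iff)
      have Av: "A v = of_real (Re v) * A 1 + of_real (Im v) * B 1"
        using real_linear_complex[OF has_derivative_linear[OF A], of v] by (simp only: AB)
      have Bv: "B v = of_real (Re v) * B 1 - of_real (Im v) * A 1"
        using real_linear_complex[OF has_derivative_linear[OF B], of v] by (simp add: laplace)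
      have "(A v - \<i> * B v) / 2 = (A 1 - \<i> * B 1) / 2 * (of_real (Re v) + \<i> * of_real (Im v))"
        unfolding Av Bv by (simp add: field_simps)
      thus "(A v - \<i> * B v) / 2 = (A 1 - \<i> * B 1) / 2 * v" by (simp only: v[symmetric])
    qed
    finally show ?thesis unfolding has_field_derivative_def by blast
  qed
  hence "deriv_z f holomorphic_on unit_disc"
    unfolding holomorphic_on_open[OF open_ball] by blast
  then obtain h0 where
    "\<And>z. z \<in> unit_disc \<Longrightarrow> (h0 has_field_derivative deriv_z f z) (at z within unit_disc)"
    by (rule holomorphic_convex_primitive'[OF convex_ball open_ball]) (rule that)
  hence h0: "(h0 has_field_derivative deriv_z f z) (at z)" if "z \<in> unit_disc" for z
    using at_within_open[OF that open_ball] that by metis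
  define h where "h z = h0 z - h0 0" for z
  have h: "(h has_field_derivative deriv_z f z) (at z)" if "z \<in> unit_disc" for z
    unfolding h_def by (auto intro!: derivative_eq_intros h0[OF that])
  define g where "g z = cnj (f z - h z)" for z
  have g: "(g has_field_derivative cnj (deriv_zbar f z)) (at z)" if z: "z \<in> unit_disc" for z
  proof -
    have "(g has_derivative (\<lambda>v. cnj (f' z v - deriv_z f z * v))) (at z)"
      unfolding g_def
      using h[OF z] by (intro bounded_linear.has_derivative[OF bounded_linear_cnj] has_derivative_diff f' z)
        (simp add: has_field_derivative_def)
    also have "(\<lambda>v. cnj (f' z v - deriv_z f z * v)) = (*) (cnj (deriv_zbar f z))"
    proof
      fix v
      have "f' z v = deriv_z f z * (of_real (Re v) + \<i> * of_real (Im v))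
          + deriv_zbar f z * (of_real (Re v) - \<i> * of_real (Im v))"
        using real_linear_complex[OF has_derivative_linear[OF f'[OF z]], of v]
        by (simp add: deriv_z_def deriv_zbar_def partial_x_def partial_y_def f'_def field_simps)
      also have "of_real (Re v) + \<i> * of_real (Im v) = v" by (simp add: complex_eq_iff)
      also have "of_real (Re v) - \<i> * of_real (Im v) = cnj v" by (simp add: complex_eq_iff)
      finally show "cnj (f' z v - deriv_z f z * v) = cnj (deriv_zbar f z) * v" by simp
    qed
    finally show ?thesis by (simp add: has_field_derivative_def)
  qed
  have "h holomorphic_on unit_disc" "g holomorphic_on unit_disc"
    unfolding holomorphic_on_open[OF open_ball] using h g by blast+
  hence "canonical_decomp f h g"
    using f0 by (simp add: canonical_decomp_def h_def g_def)
  thus ?thesis by (rule that)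
qed

text \<open>
  The derivative of \<open>h\<close> is determined by \<open>f\<close>, as it equals \<open>deriv_z f\<close>.
\<close>

lemma canonical_decomp_unique:
  assumes 1: "canonical_decomp f h g" and 2: "canonical_decomp f h' g'" and z: "z \<in> unit_disc"
  shows "h' z = h z" and "g' z = g z"
proof -
  note D = 1[unfolded canonical_decomp_def] 2[unfolded canonical_decomp_def]
  have "deriv h' w = deriv h w" if "w \<in> unit_disc" for w
    using holomorphic_plus_cnj_derivs(4)[of h unit_disc g w f]
      holomorphic_plus_cnj_derivs(4)[of h' unit_disc g' w f] D that by simp
  hence "((\<lambda>w. h' w - h w) has_field_derivative 0) (at w within unit_disc)" if "w \<in> unit_disc" for w
    using that D holomorphic_derivI[of h unit_disc w] holomorphic_derivI[of h' unit_disc w]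
    by (auto intro!: derivative_eq_intros)
  then obtain c where c: "\<And>w. w \<in> unit_disc \<Longrightarrow> h' w - h w = c"
    using has_field_derivative_zero_constant[of unit_disc "\<lambda>w. h' w - h w"] by auto
  have "c = 0" using c[of 0] D by simp
  thus "h' z = h z" using c[OF z] by simp
  have "h z + cnj (g z) = h' z + cnj (g' z)" using D z by metis
  thus "g' z = g z" using \<open>h' z = h z\<close> by simp
qed

lemma taylor_coeff_cong:
  assumes "\<And>z. z \<in> unit_disc \<Longrightarrow> p z = q z"
  shows "taylor_coeff p n = taylor_coeff q n"
proof -
  have "eventually (\<lambda>z. p z = q z) (nhds 0)"
    using eventually_nhds_in_open[OF open_ball, of 0 0 1] assms by (auto elim!: eventually_mono)
  thus ?thesis unfolding taylor_coeff_def using higher_deriv_cong_ev by metis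
qed

lemma harmonic_conv_eq:
  assumes 1: "canonical_decomp f h g" and 2: "canonical_decomp F H G"
  shows "harmonic_conv f F z = hadamard h H z + cnj (hadamard g G z)"
  unfolding harmonic_conv_def
proof (rule the_equality)
  fix w assume "\<exists>h g H G. canonical_decomp f h g \<and> canonical_decomp F H G \<and>
    w = hadamard h H z + cnj (hadamard g G z)"
  then obtain h' g' H' G' where *: "canonical_decomp f h' g'" "canonical_decomp F H' G'"
    "w = hadamard h' H' z + cnj (hadamard g' G' z)" by blast
  have "taylor_coeff h' n = taylor_coeff h n" "taylor_coeff g' n = taylor_coeff g n" for n
    using canonical_decomp_unique[OF 1 *(1)] by (auto intro: taylor_coeff_cong)
  moreover have "taylor_coeff H' n = taylor_coeff H n" "taylor_coeff G' n = taylor_coeff G n" for n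
    using canonical_decomp_unique[OF 2 *(2)] by (auto intro: taylor_coeff_cong)
  ultimately show "w = hadamard h H z + cnj (hadamard g G z)"
    unfolding *(3) hadamard_def by simp
qed (use assms in blast)

section \<open>Convolution with a convex function\<close>

lemma taylor_sums:
  assumes "p holomorphic_on unit_disc" "z \<in> unit_disc"
  shows "(\<lambda>n. taylor_coeff p n * z ^ n) sums p z"
  using holomorphic_power_series[OF assms] by (simp add: taylor_coeff_def)

lemma taylor_summable:
  assumes p: "p holomorphic_on unit_disc" and z: "z \<in> unit_disc"
  shows "summable (\<lambda>n. cmod (taylor_coeff p n * z ^ n))"
proof -
  define s where "s = (1 + cmod z) / 2"
  have "cmod z < s" "s < 1" using z by (auto simp: s_def)
  moreover from this have "0 < s" using norm_ge_zero[of z] by linarith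
  ultimately have s: "of_real s \<in> unit_disc" "cmod z < cmod (of_real s :: complex)" by simp_all
  show ?thesis using sums_summable[OF taylor_sums[OF p s(1)]] s(2) by (rule powser_insidea)
qed

lemma taylor_coeff_deriv: "taylor_coeff (deriv p) n = of_nat (Suc n) * taylor_coeff p (Suc n)"
  unfolding taylor_coeff_def funpow_Suc_right o_def fact_Suc by (simp del: of_nat_Suc)

lemma taylor_coeff_0_1 [simp]: "taylor_coeff p 0 = p 0" "taylor_coeff p (Suc 0) = deriv p 0"
  by (simp_all add: taylor_coeff_def)

text \<open>
  Split \<open>z^n\<close> evenly between the two coefficient sequences: both Taylor series converge absolutely at the
  square root of \<open>z\<close>, which is still in the disc.
\<close>

lemma taylor_product_summable:
  assumes p: "p holomorphic_on unit_disc" and q: "q holomorphic_on unit_disc" and z: "z \<in> unit_disc"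
  shows "summable (\<lambda>n. taylor_coeff p n * taylor_coeff q n * z ^ n)"
proof -
  have "csqrt z \<in> unit_disc" using z by (simp add: norm_csqrt real_sqrt_lt_1_iff)
  from summable_norm_mult[OF taylor_summable[OF p this] taylor_summable[OF q this]]
  have "summable (\<lambda>n. taylor_coeff p n * csqrt z ^ n * (taylor_coeff q n * csqrt z ^ n))"
    by (rule summable_norm_cancel)
  also have "(\<lambda>n. taylor_coeff p n * csqrt z ^ n * (taylor_coeff q n * csqrt z ^ n))
      = (\<lambda>n. taylor_coeff p n * taylor_coeff q n * (csqrt z ^ 2) ^ n)"
    by (simp add: power2_eq_square power_mult_distrib mult_ac)
  finally show ?thesis by simp
qed

lemma hadamard_deriv:
  assumes p: "p holomorphic_on unit_disc" and q: "q holomorphic_on unit_disc" and z: "z \<in> unit_disc"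
  shows "(hadamard p q has_field_derivative
    (\<Sum>n. taylor_coeff p (Suc n) * taylor_coeff (deriv q) n * z ^ n)) (at z)"
proof -
  define c where "c n = taylor_coeff p n * taylor_coeff q n" for n
  define s where "s = (1 + cmod z) / 2"
  have "cmod z < s" "s < 1" using z by (auto simp: s_def)
  moreover from this have "0 < s" using norm_ge_zero[of z] by linarith
  ultimately have s: "of_real s \<in> unit_disc" "cmod z < cmod (of_real s :: complex)" by simp_all
  have "((\<lambda>w. \<Sum>n. c n * w ^ n) has_field_derivative (\<Sum>n. diffs c n * z ^ n)) (at z)"
    by (rule termdiffs_strong[OF _ s(2)]) (use taylor_product_summable[OF p q s(1)] in \<open>simp add: c_def\<close>)
  hence "((\<lambda>w. (\<Sum>n. c n * w ^ n) - c 0) has_field_derivative (\<Sum>n. diffs c n * z ^ n)) (at z)"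
    by (auto intro!: derivative_eq_intros)
  moreover have "(\<Sum>n. c n * w ^ n) - c 0 = hadamard p q w" if w: "w \<in> unit_disc" for w
    using suminf_split_head[of "\<lambda>n. c n * w ^ n"] taylor_product_summable[OF p q w]
    by (simp add: hadamard_def c_def)
  ultimately have "(hadamard p q has_field_derivative (\<Sum>n. diffs c n * z ^ n)) (at z)"
    using has_field_derivative_transform_within_open[OF _ open_ball z] by blast
  thus ?thesis by (simp add: diffs_def c_def taylor_coeff_deriv mult_ac)
qed

lemma hadamard_holomorphic:
  assumes "p holomorphic_on unit_disc" "q holomorphic_on unit_disc"
  shows "hadamard p q holomorphic_on unit_disc"
  unfolding holomorphic_on_open[OF open_ball] using hadamard_deriv[OF assms] by blast

lemma hadamard_at_0 [simp]: "hadamard p q 0 = 0"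
  by (simp add: hadamard_def)

lemma deriv_hadamard_at_0:
  assumes "p holomorphic_on unit_disc" "q holomorphic_on unit_disc"
  shows "deriv (hadamard p q) 0 = deriv p 0 * deriv q 0"
  using DERIV_imp_deriv[OF hadamard_deriv[OF assms, of 0]] by simp

lemma hadamard_linear_right:
  assumes p: "p holomorphic_on unit_disc" and h: "h holomorphic_on unit_disc"
    and g: "g holomorphic_on unit_disc" and z: "z \<in> unit_disc"
  shows "hadamard p (\<lambda>w. h w + a * g w) z = hadamard p h z + a * hadamard p g z"
proof -
  have sm: "summable (\<lambda>n. taylor_coeff p (Suc n) * taylor_coeff q (Suc n) * z ^ Suc n)"
    if "q holomorphic_on unit_disc" for q
    using taylor_product_summable[OF p that z] by (subst summable_Suc_iff)
  have "taylor_coeff (\<lambda>w. h w + a * g w) n = taylor_coeff h n + a * taylor_coeff g n" for n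
    using higher_deriv_add[OF h holomorphic_on_mult[OF holomorphic_on_const g] open_ball, of 0 n a]
      higher_deriv_cmult[OF g _ open_ball, of 0 n a]
    by (simp add: taylor_coeff_def add_divide_distrib)
  hence "hadamard p (\<lambda>w. h w + a * g w) z =
      (\<Sum>n. taylor_coeff p (Suc n) * taylor_coeff h (Suc n) * z ^ Suc n
        + a * (taylor_coeff p (Suc n) * taylor_coeff g (Suc n) * z ^ Suc n))"
    by (simp add: hadamard_def algebra_simps)
  also have "\<dots> = hadamard p h z + a * hadamard p g z"
    unfolding hadamard_def
    by (simp only: suminf_add[OF sm[OF h] summable_mult[OF sm[OF g]], symmetric] suminf_mult[OF sm[OF g]])
  finally show ?thesis .
qed

lemma hadamard_scale_left:
  assumes p: "p holomorphic_on unit_disc" and g: "g holomorphic_on unit_disc" and z: "z \<in> unit_disc"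
  shows "hadamard (\<lambda>w. a * p w) g z = a * hadamard p g z"
proof -
  have "summable (\<lambda>n. taylor_coeff p (Suc n) * taylor_coeff g (Suc n) * z ^ Suc n)"
    using taylor_product_summable[OF p g z] by (subst summable_Suc_iff)
  moreover have "taylor_coeff (\<lambda>w. a * p w) n = a * taylor_coeff p n" for n
    using higher_deriv_cmult[OF p _ open_ball, of 0 n a] by (simp add: taylor_coeff_def)
  ultimately show ?thesis
    unfolding hadamard_def using suminf_mult[of _ a] by (simp add: mult.assoc)
qed

text \<open>
  The derivative of the convolution multiplies the coefficients of \<open>\<phi>(z)/z\<close> and of \<open>F'\<close>. Writing
  \<open>z = \<rho> \<zeta>\<close> with \<open>\<rho>\<close> and \<open>|\<zeta>|\<close> both below \<open>1\<close> moves both series to circles inside the disc, where they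
  converge absolutely; on the circle of radius \<open>|\<zeta>|\<close> the Schwarz lemma gives \<open>|F' - 1| \<le> r |\<zeta>|\<close>, which
  makes the final inequality strict.
\<close>

lemma hadamard_deriv_bound:
  assumes \<phi>: "\<phi> \<in> convex_univalent" and F: "F holomorphic_on unit_disc" "deriv F 0 = 1"
    and bound: "\<And>w. w \<in> unit_disc \<Longrightarrow> cmod (deriv F w - 1) < r" and z: "z \<in> unit_disc"
  shows "cmod (deriv (hadamard \<phi> F) z - 1) < r"
proof -
  note c = convex_univalentD[OF \<phi>]
  have F': "deriv F holomorphic_on unit_disc" using F(1) by (rule holomorphic_deriv) simp
  have r: "r > 0" using bound[of 0] F(2) by simp
  define \<rho> where "\<rho> = (1 + cmod z) / 2"
  define \<zeta> where "\<zeta> = z / of_real \<rho>"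
  have \<rho>: "0 < \<rho>" "\<rho> < 1" "cmod z < \<rho>" using z by (auto simp: \<rho>_def add_pos_nonneg)
  have \<zeta>: "cmod \<zeta> < 1" "z = of_real \<rho> * \<zeta>"
    using \<rho> by (auto simp: \<zeta>_def norm_divide)
  define a where "a n = taylor_coeff \<phi> (Suc n) * of_real \<rho> ^ n" for n
  define e where "e n = taylor_coeff (deriv F) n * \<zeta> ^ n" for n
  define d where "d n = e n - (if n = 0 then 1 else 0)" for n
  have a_sum: "summable (\<lambda>n. cmod (a n))"
  proof -
    have "summable (\<lambda>n. cmod (taylor_coeff \<phi> (Suc n) * of_real \<rho> ^ Suc n))"
      using taylor_summable[OF c(1), of "of_real \<rho>"] \<rho> by (subst summable_Suc_iff) auto
    from summable_mult[OF this, of "1 / \<rho>"] show ?thesis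
      using \<rho>(1) by (simp add: a_def norm_mult norm_power field_simps)
  qed
  have e_sum: "summable (\<lambda>n. cmod (e n))"
    unfolding e_def using taylor_summable[OF F', of \<zeta>] \<zeta> by simp
  have one_sums: "(\<lambda>n. (if n = 0 then 1 else 0) * f n) sums f 0" for f :: "nat \<Rightarrow> complex"
    using sums_single[of 0 f] by (simp add: if_distrib[of "\<lambda>x. x * _"] cong: if_cong)
  have d_sum: "summable (\<lambda>n. cmod (d n))"
  proof (rule summable_comparison_test_ev[OF _ e_sum])
    show "eventually (\<lambda>n. norm (cmod (d n)) \<le> cmod (e n)) sequentially"
      using eventually_gt_at_top[of 0] by eventually_elim (simp add: d_def)
  qed
  have "cmod (\<Sum>n. a n * d n) \<le> r * cmod \<zeta>"
  proof (rule hadamard_sum_bound[OF a_sum _ d_sum])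
    show "a 0 = 1" using c(4) by (simp add: a_def)
    show "d 0 = 0" using F(2) by (simp add: d_def e_def)
    fix w :: complex assume w: "cmod w = 1"
    have \<rho>w: "of_real \<rho> * w \<in> unit_disc" "of_real \<rho> * w \<noteq> 0"
      using w \<rho> by (auto simp: norm_mult)
    have "(\<lambda>n. taylor_coeff \<phi> (Suc n) * (of_real \<rho> * w) ^ Suc n) sums \<phi> (of_real \<rho> * w)"
      using taylor_sums[OF c(1) \<rho>w(1)] c(3) by (subst sums_Suc_iff) simp
    from sums_divide[OF this, of "of_real \<rho> * w"]
    have "(\<lambda>n. a n * w ^ n) sums (\<phi> (of_real \<rho> * w) / (of_real \<rho> * w))"
      using \<rho>w(2) by (simp add: a_def power_mult_distrib mult_ac)
    thus "Re (\<Sum>n. a n * w ^ n) \<ge> 1 / 2"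
      using marx_strohhaecker[OF \<phi> \<rho>w] by (simp add: sums_iff)
    have \<zeta>w: "\<zeta> * w \<in> unit_disc" using w \<zeta>(1) by (simp add: norm_mult)
    have "(\<lambda>n. e n * w ^ n) sums deriv F (\<zeta> * w)"
      using taylor_sums[OF F' \<zeta>w] by (simp add: e_def power_mult_distrib mult_ac)
    from sums_diff[OF this one_sums[of "\<lambda>n. w ^ n"]]
    have "(\<lambda>n. d n * w ^ n) sums (deriv F (\<zeta> * w) - 1)"
      by (simp add: d_def left_diff_distrib)
    moreover have "cmod (deriv F (\<zeta> * w) - 1) \<le> r * cmod \<zeta>"
    proof -
      have "cmod ((deriv F (\<zeta> * w) - 1) / of_real r) \<le> cmod (\<zeta> * w)"
        by (rule Schwarz_Lemma(1)[where f = "\<lambda>x. (deriv F x - 1) / of_real r"])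
          (use F(2) F' r bound \<zeta>w in \<open>auto intro!: holomorphic_intros simp: norm_divide\<close>)
      thus ?thesis using r w by (simp add: norm_divide norm_mult field_simps)
    qed
    ultimately show "cmod (\<Sum>n. d n * w ^ n) \<le> r * cmod \<zeta>" by (simp add: sums_iff)
  qed
  also have "r * cmod \<zeta> < r" using r \<zeta>(1) by simp
  also have "(\<Sum>n. a n * d n) = deriv (hadamard \<phi> F) z - 1"
  proof -
    have "summable (\<lambda>n. a n * e n)"
      using summable_norm_mult[OF a_sum e_sum] by (rule summable_norm_cancel)
    moreover have "(\<lambda>n. a n * e n) = (\<lambda>n. taylor_coeff \<phi> (Suc n) * taylor_coeff (deriv F) n * z ^ n)"
      by (simp add: fun_eq_iff a_def e_def \<zeta>(2) power_mult_distrib)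
    ultimately have "(\<lambda>n. a n * e n) sums deriv (hadamard \<phi> F) z"
      using DERIV_imp_deriv[OF hadamard_deriv[OF c(1) F(1) z]] by (simp add: sums_iff)
    from sums_diff[OF this one_sums[of a]] show ?thesis
      using c(4) by (simp add: d_def left_diff_distrib right_diff_distrib sums_iff a_def mult.commute)
  qed
  finally show ?thesis .
qed

theorem theorem4p3:
  fixes r :: real and \<phi> f :: "complex \<Rightarrow> complex" and \<alpha> :: complex
  assumes "0 < r" and "r \<le> 1"
    and "\<phi> \<in> convex_univalent"
    and "f \<in> FH0 r"
    and "cmod \<alpha> \<le> 1"
  shows "harmonic_conv (\<lambda>z. \<alpha> * cnj (\<phi> z) + \<phi> z) f \<in> FH0 r"
proof -
  note c = convex_univalentD[OF assms(3)]
  have f: "harmonic_on f unit_disc" "f 0 = 0" "deriv_z f 0 = 1" "deriv_zbar f 0 = 0"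
    "\<And>z. z \<in> unit_disc \<Longrightarrow> cmod (deriv_z f z - 1) < r - cmod (deriv_zbar f z)"
    using assms(4) by (auto simp: FH0_def)
  obtain h g where hg: "canonical_decomp f h g"
    using harmonic_imp_canonical_decomp[OF f(1,2)] .
  hence h: "h holomorphic_on unit_disc" and g: "g holomorphic_on unit_disc"
    and f_eq: "\<And>z. z \<in> unit_disc \<Longrightarrow> f z = h z + cnj (g z)"
    by (auto simp: canonical_decomp_def)
  note fd = holomorphic_plus_cnj_derivs(4,5)[OF h g open_ball _ f_eq]
  have h0: "deriv h 0 = 1" and g0: "deriv g 0 = 0" using f(3,4) fd[of 0] by simp_all
  have bound: "cmod (deriv h z - 1) < r - cmod (deriv g z)" if "z \<in> unit_disc" for z
    using f(5)[OF that] fd[OF that] by simp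
  define H where "H = hadamard \<phi> h"
  define G where "G = hadamard \<phi> g"
  define K where "K = hadamard (\<lambda>z. cnj \<alpha> * \<phi> z) g"
  define P where "P = harmonic_conv (\<lambda>z. \<alpha> * cnj (\<phi> z) + \<phi> z) f"
  have \<alpha>\<phi>: "(\<lambda>z. cnj \<alpha> * \<phi> z) holomorphic_on unit_disc" by (intro holomorphic_intros c(1))
  have hol: "H holomorphic_on unit_disc" "G holomorphic_on unit_disc" "K holomorphic_on unit_disc"
    unfolding H_def G_def K_def by (intro hadamard_holomorphic c(1) \<alpha>\<phi> h g)+
  have "canonical_decomp (\<lambda>z. \<alpha> * cnj (\<phi> z) + \<phi> z) \<phi> (\<lambda>z. cnj \<alpha> * \<phi> z)"
    using c(1,3) \<alpha>\<phi> by (simp add: canonical_decomp_def)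
  from harmonic_conv_eq[OF this hg] have P: "P z = H z + cnj (K z)" for z
    by (simp add: P_def H_def K_def)
  note Pd = holomorphic_plus_cnj_derivs(4,5)[OF hol(1,3) open_ball _ P]
  have K': "deriv K z = cnj \<alpha> * deriv G z" if z: "z \<in> unit_disc" for z
  proof -
    have "((\<lambda>w. cnj \<alpha> * G w) has_field_derivative cnj \<alpha> * deriv G z) (at z)"
      by (intro DERIV_cmult holomorphic_derivI[OF hol(2) open_ball z])
    hence "(K has_field_derivative cnj \<alpha> * deriv G z) (at z)"
      by (rule has_field_derivative_transform_within_open[OF _ open_ball z])
        (simp add: K_def G_def hadamard_scale_left[OF c(1) g])
    thus ?thesis by (rule DERIV_imp_deriv)
  qed
  \<comment> \<open>aligning the arguments of \<open>H' - 1\<close> and \<open>u G'\<close> reduces the claim to the holomorphic function \<open>h + u g\<close>\<close>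
  have main: "cmod (deriv H z - 1) + cmod (deriv G z) < r" if z: "z \<in> unit_disc" for z
  proof -
    obtain u where u: "cmod u = 1" "cmod (deriv H z - 1) + cmod (deriv G z)
        = cmod ((deriv H z - 1) + u * deriv G z)"
    proof -
      define s t where "s = deriv H z - 1" and "t = deriv G z"
      \<comment> \<open>\<open>sgn 0 = 0\<close> does not have modulus \<open>1\<close>, so vanishing terms are treated apart\<close>
      define u where "u = (if s = 0 \<or> t = 0 then 1 else sgn s * cnj (sgn t))"
      have "cmod u = 1" by (simp add: u_def norm_mult norm_sgn)
      moreover have "cmod s + cmod t = cmod (s + u * t)"
      proof (cases "s = 0 \<or> t = 0")
        case False
        have "cnj (sgn t) * t = of_real (cmod t)"
          using False by (simp add: sgn_eq complex_norm_square[symmetric] power2_eq_square mult.commute)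
        hence "u * t = sgn s * of_real (cmod t)" using False by (simp add: u_def mult.assoc)
        moreover have "s = sgn s * of_real (cmod s)" using False by (simp add: sgn_eq)
        ultimately have "s + u * t = sgn s * of_real (cmod s + cmod t)"
          by (metis distrib_left of_real_add)
        thus ?thesis using False by (simp only: norm_mult norm_of_real) (simp add: norm_sgn)
      qed (auto simp: u_def)
      ultimately show ?thesis using that by (auto simp: s_def t_def)
    qed
    define F where "F w = h w + u * g w" for w
    have F: "F holomorphic_on unit_disc" unfolding F_def by (intro holomorphic_intros h g)
    have F': "deriv F w = deriv h w + u * deriv g w" if "w \<in> unit_disc" for w
      unfolding F_def
      by (intro DERIV_imp_deriv DERIV_add DERIV_cmult holomorphic_derivI[OF h open_ball that]
          holomorphic_derivI[OF g open_ball that])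
    have "cmod (deriv F w - 1) < r" if w: "w \<in> unit_disc" for w
    proof -
      have "cmod (deriv F w - 1) \<le> cmod (deriv h w - 1) + cmod (u * deriv g w)"
        using norm_triangle_ineq[of "deriv h w - 1" "u * deriv g w"] F'[OF w]
        by (simp add: algebra_simps)
      also have "cmod (u * deriv g w) = cmod (deriv g w)" using u(1) by (simp add: norm_mult)
      finally show ?thesis using bound[OF w] by simp
    qed
    moreover have "deriv F 0 = 1" using F'[of 0] h0 g0 by simp
    ultimately have "cmod (deriv (hadamard \<phi> F) z - 1) < r"
      using hadamard_deriv_bound[OF assms(3) F] z by blast
    moreover have "deriv (hadamard \<phi> F) z = deriv H z + u * deriv G z"
    proof -
      have "((\<lambda>w. H w + u * G w) has_field_derivative deriv H z + u * deriv G z) (at z)"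
        by (intro DERIV_add DERIV_cmult holomorphic_derivI[OF hol(1) open_ball z]
            holomorphic_derivI[OF hol(2) open_ball z])
      hence "(hadamard \<phi> F has_field_derivative deriv H z + u * deriv G z) (at z)"
        by (rule has_field_derivative_transform_within_open[OF _ open_ball z])
          (simp add: F_def[abs_def] H_def G_def hadamard_linear_right[OF c(1) h g])
      thus ?thesis by (rule DERIV_imp_deriv)
    qed
    ultimately show ?thesis using u(2) by (simp add: algebra_simps)
  qed
  have "P \<in> FH0 r"
    unfolding FH0_def
  proof (intro CollectI conjI ballI)
    show "harmonic_on P unit_disc"
      by (rule harmonic_on_holomorphic_plus_cnj[OF hol(1,3) open_ball P])
    show "P 0 = 0" by (simp add: P H_def K_def)
    have "deriv H 0 = 1" "deriv G 0 = 0"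
      using deriv_hadamard_at_0[OF c(1) h] deriv_hadamard_at_0[OF c(1) g] c(4) h0 g0
      by (simp_all add: H_def G_def)
    thus "deriv_z P 0 = 1" "deriv_zbar P 0 = 0" using Pd[of 0] K'[of 0] by simp_all
    fix z assume z: "z \<in> unit_disc"
    have "cmod (deriv K z) \<le> cmod (deriv G z)"
      using K'[OF z] assms(5) by (simp add: norm_mult mult_left_le_one_le)
    thus "cmod (deriv_z P z - 1) < r - cmod (deriv_zbar P z)"
      using main[OF z] Pd[OF z] by simp
  qed
  thus ?thesis by (simp add: P_def)
qed

end
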